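(* Lipschitz dimension is not a snowflake invariant, and hence not a quasisymmetric invariant: there exist metric spaces $X$ and $Y$ and a surjective snowflake map $f\colon X\to Y$ (in particular, a quasisymmetric homeomorphism) such that $\dim_L(X)\ne\dim_L(Y)$.
   Context: Snowflake map: a map $f\colon X\to Y$ for which there are $\alpha\in(0,1]$ and $C>0$ with $C^{-1}d(x,y)^\alpha\le d(f(x),f(y))\le Cd(x,y)^\alpha$ for all $x,y\in X$. Quasisymmetric: an embedding $f\colon X\to Y$ is quasisymmetric if there is a homeomorphism $\eta\colon[0,\infty)\to[0,\infty)$ such that $d(x,a)\le t\,d(x,b)$ implies $d(f(x),f(a))\le\eta(t)\,d(f(x),f(b))$ for all $a,b,x\in X$ and $t\ge0$. Every snowflake map is quasisymmetric. Lipschitz dimension: for $r>0$, an $r$-path in a metric space $X$ is a finite sequence $(x_1,\dots,x_k)$ in $X$ with $d(x_i,x_{i+1})\le r$ for $1\le i\le k-1$. Two points are in the same $r$-component of $X$ if some $r$-path in $X$ contains both. The $r$-components of a subset are those of the subset as a metric space. A map $f\colon X\to Y$ is Lipschitz light if there is $C>0$ such that $f$ is $C$-Lipschitz and, for every $r>0$ and every $W\subset Y$ with $\mathrm{diam}(W)\le r$, the $r$-components of $f^{-1}(W)$ have diameter at most $Cr$. $\dim_L(X)$ is the minimal integer $n\ge0$ such that there is a Lipschitz light map $X\to\mathbb{R}^n$ (with $\mathbb{R}^0$ a one-point space), or $\infty$ if there is none. *)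

theory Defs
  imports "HOL-Analysis.Analysis" "HOL-Library.Extended_Nat"
begin

text \<open>Metric spaces are elements of the library type \<open>'a metric\<close>: a carrier \<open>mspace X\<close> together
  with a distance \<open>mdist X\<close> that is meaningful on the carrier. Existence statements
  about metric spaces have to fix the type \<open>'a\<close>; taking \<open>nat \<Rightarrow> real\<close> only bounds the cardinality of
  the carrier by that of the continuum, since both carrier and distance remain arbitrary.\<close>

definition snowflake_map :: "'a metric \<Rightarrow> 'b metric \<Rightarrow> ('a \<Rightarrow> 'b) \<Rightarrow> bool" where
  "snowflake_map X Y f \<longleftrightarrow>
     f \<in> mspace X \<rightarrow> mspace Y \<and>
     (\<exists>\<alpha> C. 0 < \<alpha> \<and> \<alpha> \<le> 1 \<and> C > 0 \<and>
        (\<forall>x\<in>mspace X. \<forall>y\<in>mspace X.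
           inverse C * mdist X x y powr \<alpha> \<le> mdist Y (f x) (f y) \<and>
           mdist Y (f x) (f y) \<le> C * mdist X x y powr \<alpha>))"

definition quasisymmetric_map :: "'a metric \<Rightarrow> 'b metric \<Rightarrow> ('a \<Rightarrow> 'b) \<Rightarrow> bool" where
  "quasisymmetric_map X Y f \<longleftrightarrow>
     embedding_map (mtopology_of X) (mtopology_of Y) f \<and>
     (\<exists>\<eta> :: real \<Rightarrow> real.
        homeomorphic_map (top_of_set {0..}) (top_of_set {0..}) \<eta> \<and>
        (\<forall>x\<in>mspace X. \<forall>a\<in>mspace X. \<forall>b\<in>mspace X. \<forall>t\<ge>0.
           mdist X x a \<le> t * mdist X x b \<longrightarrow>
           mdist Y (f x) (f a) \<le> \<eta> t * mdist Y (f x) (f b)))"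

text \<open>The diameter takes values in \<open>[0, \<infinity>]\<close>; unbounded sets have diameter \<open>\<infinity>\<close> and the
  empty set has diameter \<open>0\<close>.\<close>

definition mdiameter :: "'a metric \<Rightarrow> 'a set \<Rightarrow> ennreal" where
  "mdiameter X S = (SUP x\<in>S. SUP y\<in>S. ennreal (mdist X x y))"

definition r_path :: "'a metric \<Rightarrow> real \<Rightarrow> 'a list \<Rightarrow> bool" where
  "r_path X r xs \<longleftrightarrow> set xs \<subseteq> mspace X \<and> successively (\<lambda>x y. mdist X x y \<le> r) xs"

definition same_r_component :: "'a metric \<Rightarrow> real \<Rightarrow> 'a \<Rightarrow> 'a \<Rightarrow> bool" where
  "same_r_component X r x y \<longleftrightarrow> (\<exists>xs. r_path X r xs \<and> x \<in> set xs \<and> y \<in> set xs)"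

definition r_components :: "'a metric \<Rightarrow> real \<Rightarrow> 'a set set" where
  "r_components X r = mspace X // {(x, y). same_r_component X r x y}"

text \<open>In \<open>submetric X (f -` W)\<close> the preimage is automatically intersected with \<open>mspace X\<close>.\<close>

definition Lipschitz_light :: "'a metric \<Rightarrow> 'b metric \<Rightarrow> ('a \<Rightarrow> 'b) \<Rightarrow> bool" where
  "Lipschitz_light X Y f \<longleftrightarrow>
     f \<in> mspace X \<rightarrow> mspace Y \<and>
     (\<exists>C>0.
        (\<forall>x\<in>mspace X. \<forall>y\<in>mspace X. mdist Y (f x) (f y) \<le> C * mdist X x y) \<and>
        (\<forall>r>0. \<forall>W\<subseteq>mspace Y. mdiameter Y W \<le> ennreal r \<longrightarrow>
           (\<forall>K\<in>r_components (submetric X (f -` W)) r. mdiameter X K \<le> ennreal (C * r))))"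

text \<open>\<open>\<real>\<^sup>n\<close> for a varying \<open>n\<close>: real sequences vanishing from index \<open>n\<close> on, with the Euclidean
  distance. The carrier is that of the library topology \<open>Euclidean_space n\<close>; for \<open>n = 0\<close> it is a
  single point.\<close>

definition Euclidean_metric :: "nat \<Rightarrow> (nat \<Rightarrow> real) metric" where
  "Euclidean_metric n =
     metric (topspace (Euclidean_space n), \<lambda>x y. L2_set (\<lambda>i. x i - y i) {..<n})"

lemma Metric_space_Euclidean_metric:
  "Metric_space (topspace (Euclidean_space n)) (\<lambda>x y. L2_set (\<lambda>i. x i - y i) {..<n})"
proof
  fix x y z :: "nat \<Rightarrow> real"
  show "0 \<le> L2_set (\<lambda>i. x i - y i) {..<n}" by simp
  show "L2_set (\<lambda>i. x i - y i) {..<n} = L2_set (\<lambda>i. y i - x i) {..<n}"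
    by (simp add: L2_set_def power2_commute)
  show "L2_set (\<lambda>i. x i - z i) {..<n}
          \<le> L2_set (\<lambda>i. x i - y i) {..<n} + L2_set (\<lambda>i. y i - z i) {..<n}"
    using L2_set_triangle_ineq[of "\<lambda>i. x i - y i" "\<lambda>i. y i - z i" "{..<n}"] by simp
  assume "x \<in> topspace (Euclidean_space n)" "y \<in> topspace (Euclidean_space n)"
  then have "x i = y i" if "\<not> i < n" for i
    using that by (simp add: topspace_Euclidean_space)
  then show "L2_set (\<lambda>i. x i - y i) {..<n} = 0 \<longleftrightarrow> x = y"
    by (auto simp: L2_set_eq_0_iff fun_eq_iff)
qed

lemma mspace_Euclidean_metric [simp]: "mspace (Euclidean_metric n) = {x. \<forall>i\<ge>n. x i = 0}"
  unfolding Euclidean_metric_def Metric_space.mspace_metric[OF Metric_space_Euclidean_metric]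
  by (rule topspace_Euclidean_space)

lemma mdist_Euclidean_metric [simp]:
  "mdist (Euclidean_metric n) = (\<lambda>x y. L2_set (\<lambda>i. x i - y i) {..<n})"
  unfolding Euclidean_metric_def
  by (rule Metric_space.mdist_metric[OF Metric_space_Euclidean_metric])

text \<open>If there is no Lipschitz light map into any \<open>\<real>\<^sup>n\<close>, the infimum is over the empty set and
  equals \<open>\<infinity>\<close>.\<close>

definition Lipschitz_dim :: "'a metric \<Rightarrow> enat" where
  "Lipschitz_dim X = (INF n\<in>{n. \<exists>f. Lipschitz_light X (Euclidean_metric n) f}. enat n)"

end

theory Submission
  imports Defs "HOL-Library.Countable" "HOL-Library.Sublist"
begin

text \<open>The example is a metric space \<open>X\<close> together with the same set under the square root of its
  distance. The identity is then a snowflake map with exponent \<open>1/2\<close>, and the claim becomes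
  \<open>dim\<^sub>L X = \<infinity>\<close> while \<open>dim\<^sub>L\<close> of the snowflake is at most \<open>5\<close>.

  The space \<open>X\<close> is obtained by iterated substitution. An edge of length \<open>l\<close> is replaced by a
  family of midpoints indexed by \<open>\<rat>\<close>, each joined to both ends of the edge by new edges of length
  \<open>l/2\<close>, while the midpoints themselves form a path along which the parameters \<open>p\<close> and \<open>q\<close> are at
  distance about \<open>l * \<bar>p - q\<bar>\<close> (but never more than \<open>l\<close>). The new edges are subdivided in the same
  way, and so on. Only the vertices are kept; they are countable, which is why \<open>nat \<Rightarrow> real\<close> can carry
  them.

  \<^emph>\<open>Why \<open>dim\<^sub>L X = \<infinity>\<close>.\<close> Let \<open>f : X \<rightarrow> \<real>\<^sup>n\<close> be Lipschitz and let \<open>\<sigma>\<close> be the supremum of the slopes of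
  \<open>f\<close> over all edges. On an edge \<open>e\<close> of slope almost \<open>\<sigma>\<close>, every midpoint is the end of two halves of
  slope at most \<open>\<sigma>\<close>, so by the parallelogram law its image is close to the centre of the segment
  spanned by the images of the ends of \<open>e\<close> (\<open>metric_midpoints_cluster\<close>). Hence the whole path of
  midpoints, which has diameter comparable to \<open>l\<close>, is sent into a set of diameter much smaller than
  \<open>l\<close>; as the path has arbitrarily fine subdivisions, \<open>f\<close> is not Lipschitz light
  (\<open>no_Lipschitz_light_edge_space\<close>).

  \<^emph>\<open>Why the snowflake has finite dimension.\<close> At every scale \<open>s\<close> the space \<open>X\<close> is a union of five
  families, each consisting of sets of diameter at most \<open>12 s\<close> with mutual distances larger than \<open>s\<close>
  (\<open>edge_space_separated_cover\<close>): it has finite Nagata dimension. For a bounded space this is enough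
  (\<open>Lipschitz_dim_sqrt_metric_le\<close>): for each family, the tent functions around its sets at the scales
  \<open>\<beta>\<^sup>2\<^sup>k\<close> are summed with weights \<open>\<beta>\<^sup>k\<close>. Thanks to the square root, at each scale the contributions of
  all coarser and all finer scales are only a small fraction of that of the scale itself, provided
  \<open>\<beta>\<close> is small, so the sum inherits from each single tent that it changes along every chain leaving
  a neighbourhood of a set of the family.\<close>

section \<open>The square root snowflake\<close>

definition sqrt_metric :: "'a metric \<Rightarrow> 'a metric" where
  "sqrt_metric X = metric (mspace X, \<lambda>x y. sqrt (mdist X x y))"

lemma Metric_space_sqrt: "Metric_space (mspace X) (\<lambda>x y. sqrt (mdist X x y))"
proof
  fix x y z
  show "0 \<le> sqrt (mdist X x y)" by simp
  show "sqrt (mdist X x y) = sqrt (mdist X y x)" by (simp add: mdist_commute)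
  assume xy: "x \<in> mspace X" "y \<in> mspace X"
  then show "sqrt (mdist X x y) = 0 \<longleftrightarrow> x = y" by simp
  assume z: "z \<in> mspace X"
  have "sqrt (mdist X x z) \<le> sqrt (mdist X x y + mdist X y z)"
    using mdist_triangle[OF xy z] by simp
  also have "\<dots> \<le> sqrt (mdist X x y) + sqrt (mdist X y z)"
    by (rule sqrt_add_le_add_sqrt) auto
  finally show "sqrt (mdist X x z) \<le> sqrt (mdist X x y) + sqrt (mdist X y z)" .
qed

lemma mspace_sqrt_metric [simp]: "mspace (sqrt_metric X) = mspace X"
  unfolding sqrt_metric_def by (rule Metric_space.mspace_metric[OF Metric_space_sqrt])

lemma mdist_sqrt_metric [simp]: "mdist (sqrt_metric X) = (\<lambda>x y. sqrt (mdist X x y))"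
  unfolding sqrt_metric_def by (rule Metric_space.mdist_metric[OF Metric_space_sqrt])

lemma mtopology_of_sqrt_metric: "mtopology_of (sqrt_metric X) = mtopology_of X"
proof -
  have "openin (mtopology_of (sqrt_metric X)) U \<longleftrightarrow> openin (mtopology_of X) U" for U
  proof -
    let ?B = "\<lambda>\<rho>. Metric_space.mball (mspace X) \<rho>"
    have sq: "sqrt a < r \<longleftrightarrow> a < r\<^sup>2" if "0 < r" for a r :: real
      using that real_sqrt_less_iff[of a "r\<^sup>2"] by (simp del: real_sqrt_less_iff)
    have ball: "?B (\<lambda>x y. sqrt (mdist X x y)) x r = ?B (mdist X) x (r\<^sup>2)" if "r > 0" for x r
      unfolding Metric_space.mball_def[OF Metric_space_sqrt[of X]]
        Metric_space.mball_def[OF Metric_space_mspace_mdist[of X]] sq[OF that] ..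
    have "(\<exists>r>0. ?B (\<lambda>x y. sqrt (mdist X x y)) x r \<subseteq> U) \<longleftrightarrow> (\<exists>r>0. ?B (mdist X) x r \<subseteq> U)" for x
    proof
      assume "\<exists>r>0. ?B (\<lambda>x y. sqrt (mdist X x y)) x r \<subseteq> U"
      then obtain r where "r > 0" "?B (\<lambda>x y. sqrt (mdist X x y)) x r \<subseteq> U" by blast
      with ball show "\<exists>r>0. ?B (mdist X) x r \<subseteq> U" by (intro exI[of _ "r\<^sup>2"]) simp
    next
      assume "\<exists>r>0. ?B (mdist X) x r \<subseteq> U"
      then obtain r where "r > 0" "?B (mdist X) x r \<subseteq> U" by blast
      with ball[of "sqrt r"] show "\<exists>r>0. ?B (\<lambda>x y. sqrt (mdist X x y)) x r \<subseteq> U"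
        by (intro exI[of _ "sqrt r"]) simp
    qed
    then show ?thesis
      unfolding mtopology_of_def mspace_sqrt_metric mdist_sqrt_metric
        Metric_space.openin_mtopology[OF Metric_space_sqrt[of X]]
        Metric_space.openin_mtopology[OF Metric_space_mspace_mdist[of X]] by simp
  qed
  then show ?thesis by (simp add: topology_eq)
qed

lemma homeomorphic_map_id_sqrt_metric:
  "homeomorphic_map (mtopology_of X) (mtopology_of (sqrt_metric X)) id"
  by (simp add: mtopology_of_sqrt_metric)

lemma snowflake_map_id_sqrt_metric: "snowflake_map X (sqrt_metric X) id"
  unfolding snowflake_map_def
  by (rule conjI, simp, rule exI[of _ "1/2"], rule exI[of _ 1]) (simp add: powr_half_sqrt)

lemma quasisymmetric_map_id_sqrt_metric: "quasisymmetric_map X (sqrt_metric X) id"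
proof -
  have "homeomorphic_maps (top_of_set {0..}) (top_of_set {0..}) sqrt (\<lambda>x::real. x\<^sup>2)"
    unfolding homeomorphic_maps_def 
    using continuous_on_real_sqrt[OF continuous_on_id, of "{0..}"]
      continuous_on_power[OF continuous_on_id, of "{0::real..}" 2]
    by (auto simp: id_def)
  then have "homeomorphic_map (top_of_set {0..}) (top_of_set {0..}) sqrt"
    by (rule homeomorphic_maps_imp_map)
  moreover have "sqrt (mdist X x a) \<le> sqrt t * sqrt (mdist X x b)"
    if "mdist X x a \<le> t * mdist X x b" for x a b t
    using that by (simp flip: real_sqrt_mult)
  ultimately show ?thesis
    unfolding quasisymmetric_map_def
    using subtopology_topspace[of "mtopology_of X"]
    by (auto simp: embedding_map_def mtopology_of_sqrt_metric)
qed

section \<open>Diameters and chains\<close>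

lemma mdiameter_le_iff:
  assumes "0 \<le> r"
  shows "mdiameter X S \<le> ennreal r \<longleftrightarrow> (\<forall>x\<in>S. \<forall>y\<in>S. mdist X x y \<le> r)"
  using assms by (simp add: mdiameter_def SUP_le_iff ennreal_le_iff)

lemma same_r_component_imp_rtranclp:
  assumes "same_r_component X r x y"
  shows "(\<lambda>u v. u \<in> mspace X \<and> v \<in> mspace X \<and> mdist X u v \<le> r)\<^sup>*\<^sup>* x y"
proof -
  let ?R = "\<lambda>u v. u \<in> mspace X \<and> v \<in> mspace X \<and> mdist X u v \<le> r"
  have sym: "?R\<^sup>*\<^sup>* v u" if "?R\<^sup>*\<^sup>* u v" for u v
    by (rule sympD[OF symp_rtranclp that]) (auto intro!: sympI simp: mdist_commute)
  obtain xs where xs: "r_path X r xs" "x \<in> set xs" "y \<in> set xs"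
    using assms by (auto simp: same_r_component_def)
  have "?R\<^sup>*\<^sup>* (hd xs) v" if "v \<in> set xs" for v
    using xs(1) that unfolding r_path_def
  proof (induction xs)
    case (Cons a xs)
    show ?case
    proof (cases "v = a")
      case False
      with Cons.prems have v: "v \<in> set xs" "xs \<noteq> []" by auto
      then have "?R\<^sup>*\<^sup>* (hd xs) v" using Cons by (auto simp: successively_Cons)
      moreover have "?R a (hd xs)" using Cons.prems v by (auto simp: successively_Cons)
      ultimately show ?thesis using converse_rtranclp_into_rtranclp[of ?R a "hd xs" v] by simp
    qed simp
  qed simp
  with xs have "?R\<^sup>*\<^sup>* x (hd xs)" "?R\<^sup>*\<^sup>* (hd xs) y" using sym by blast+
  then show ?thesis by (rule rtranclp_trans)
qed

section \<open>Snowflakes of spaces of finite Nagata dimension\<close>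

text \<open>The condition on covers in the definition of Nagata dimension: \<open>M\<close> families, each of
  \<open>R\<close>-bounded and \<open>s\<close>-separated sets. Separation is phrased as two sets coinciding once they contain
  points at distance at most \<open>s\<close>, the form in which chains are followed.\<close>

definition separated_cover ::
    "'a metric \<Rightarrow> nat \<Rightarrow> real \<Rightarrow> real \<Rightarrow> (nat \<Rightarrow> 'a set set) \<Rightarrow> bool" where
  "separated_cover X M s R \<U> \<longleftrightarrow>
     (\<forall>c<M. \<Union>(\<U> c) \<subseteq> mspace X) \<and>
     mspace X \<subseteq> (\<Union>c<M. \<Union>(\<U> c)) \<and>
     (\<forall>c<M. \<forall>A\<in>\<U> c. \<forall>B\<in>\<U> c. (\<exists>a\<in>A. \<exists>b\<in>B. mdist X a b \<le> s) \<longrightarrow> A = B) \<and>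
     (\<forall>c<M. \<forall>A\<in>\<U> c. \<forall>a\<in>A. \<forall>b\<in>A. mdist X a b \<le> R)"

text \<open>This is \<open>max 0 (1 - dist(x, A) / s)\<close>; the inserted \<open>0\<close> also gives \<open>A = {}\<close> the value \<open>0\<close>.\<close>

definition tent :: "'a metric \<Rightarrow> real \<Rightarrow> 'a set \<Rightarrow> 'a \<Rightarrow> real" where
  "tent X s A x = Sup (insert 0 ((\<lambda>a. 1 - mdist X x a / s) ` A))"

lemma tent_bdd:
  assumes "0 < s" shows "bdd_above (insert 0 ((\<lambda>a. 1 - mdist X x a / s) ` A))"
  using assms by (intro bdd_aboveI[of _ 1]) auto

lemma tent_nonneg: "0 < s \<Longrightarrow> 0 \<le> tent X s A x"
  unfolding tent_def by (intro cSup_upper tent_bdd) auto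

lemma tent_le_1: "0 < s \<Longrightarrow> tent X s A x \<le> 1"
  unfolding tent_def by (intro cSup_least) auto

lemma tent_eq_1:
  assumes "0 < s" "x \<in> A" "x \<in> mspace X" shows "tent X s A x = 1"
proof (rule antisym[OF tent_le_1[OF assms(1)]])
  show "1 \<le> tent X s A x"
    unfolding tent_def using assms by (intro cSup_upper tent_bdd insertI2 image_eqI[of _ _ x]) auto
qed

lemma tent_pos_imp_near:
  assumes "0 < s" "0 < tent X s A x" shows "\<exists>a\<in>A. mdist X x a < s"
proof (rule ccontr)
  assume "\<not> (\<exists>a\<in>A. mdist X x a < s)"
  then have "1 \<le> mdist X x a / s" if "a \<in> A" for a
    using that assms(1) by (auto simp: not_less)
  then have "tent X s A x \<le> 0"
    unfolding tent_def by (intro cSup_least) auto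
  with assms(2) show False by simp
qed

lemma tent_le:
  assumes "0 < s" "A \<subseteq> mspace X" "x \<in> mspace X" "y \<in> mspace X"
  shows "tent X s A x \<le> tent X s A y + mdist X x y / s"
  unfolding tent_def[of _ _ _ x]
proof (rule cSup_least)
  fix t assume "t \<in> insert 0 ((\<lambda>a. 1 - mdist X x a / s) ` A)"
  then consider "t = 0" | a where "a \<in> A" "t = 1 - mdist X x a / s" by auto
  then show "t \<le> tent X s A y + mdist X x y / s"
  proof cases
    case 1
    then show ?thesis using tent_nonneg[OF assms(1), of X A y] assms(1) by simp
  next
    case 2
    have "1 - mdist X y a / s \<le> tent X s A y"
      unfolding tent_def using 2 by (intro cSup_upper tent_bdd assms) auto
    moreover have "mdist X y a \<le> mdist X x y + mdist X x a"
      using mdist_triangle[of y X x a] 2 assms by (auto simp: mdist_commute)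
    ultimately have "1 - mdist X x a / s \<le> tent X s A y + mdist X x y / s"
      using divide_right_mono[of "mdist X y a" "mdist X x y + mdist X x a" s] assms(1)
      by (simp add: add_divide_distrib)
    then show ?thesis using 2 by simp
  qed
qed simp

lemma tent_Lipschitz:
  assumes "0 < s" "A \<subseteq> mspace X" "x \<in> mspace X" "y \<in> mspace X"
  shows "\<bar>tent X s A x - tent X s A y\<bar> \<le> mdist X x y / s"
  using tent_le[OF assms] tent_le[OF assms(1,2,4,3)] by (simp add: mdist_commute)

text \<open>Let \<open>u\<close> and \<open>v\<close> be the values at two points at distance \<open>d\<close> of functions that are
  \<open>\<beta>\<^sup>-\<^sup>2\<^sup>k\<close>-Lipschitz for the original distance. Among the weighted differences
  \<open>\<beta>\<^sup>k * (u k - v k)\<close>, the terms before \<open>K\<close> are at most \<open>d / \<beta>\<^sup>k\<close> and the terms after \<open>K\<close> at most \<open>\<beta>\<^sup>k\<close>.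
  Both are geometric sums dominated by their term next to \<open>K\<close>, which brings in the small factor
  \<open>\<beta>\<close>. This is where the exponent of the snowflake being less than \<open>1\<close> enters.\<close>

lemma geometric_sum_dominated_at_one_scale:
  fixes u v :: "nat \<Rightarrow> real"
  assumes b: "0 < \<beta>" "\<beta> \<le> 1/2"
    and u: "\<And>k. 0 \<le> u k" "\<And>k. u k \<le> 1" and v: "\<And>k. 0 \<le> v k" "\<And>k. v k \<le> 1"
    and uv: "\<And>k. \<bar>u k - v k\<bar> \<le> d / (\<beta>^k)\<^sup>2"
  shows "\<bar>(\<Sum>k. \<beta>^k * u k) - (\<Sum>k. \<beta>^k * v k) - \<beta>^K * (u K - v K)\<bar>
           \<le> 2 * \<beta> * (d / \<beta>^K + \<beta>^K)"
proof -
  define w where "w k = u k - v k" for k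
  have w1: "\<bar>w k\<bar> \<le> 1" for k using u[of k] v[of k] by (simp add: w_def)
  have geo: "summable (\<lambda>k. \<beta>^k)" using b by (simp add: summable_geometric)
  have su: "summable (\<lambda>k. \<beta>^k * u k)" and sv: "summable (\<lambda>k. \<beta>^k * v k)"
    by (rule summable_comparison_test'[OF geo, of 0], use u v b in \<open>simp add: mult_left_le\<close>)+
  have eq: "(\<Sum>k. \<beta>^k * u k) - (\<Sum>k. \<beta>^k * v k) = (\<Sum>k. \<beta>^k * w k)"
    by (subst suminf_diff[OF su sv]) (simp add: w_def algebra_simps)
  have sw: "summable (\<lambda>k. \<beta>^k * w k)"
    using summable_diff[OF su sv] by (simp add: w_def algebra_simps)
  have "(\<Sum>k. \<beta>^k * w k) = (\<Sum>k. \<beta>^(k + Suc K) * w (k + Suc K)) + (\<Sum>k<Suc K. \<beta>^k * w k)"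
    by (rule suminf_split_initial_segment[OF sw])
  then have split: "(\<Sum>k. \<beta>^k * w k) - \<beta>^K * w K
      = (\<Sum>k. \<beta>^(k + Suc K) * w (k + Suc K)) + (\<Sum>k<K. \<beta>^k * w k)" by simp
  have tail: "\<bar>\<Sum>k. \<beta>^(k + Suc K) * w (k + Suc K)\<bar> \<le> 2 * \<beta> * \<beta>^K"
  proof -
    have s: "summable (\<lambda>k. \<beta>^(k + Suc K))" using geo by (rule summable_ignore_initial_segment)
    have "\<bar>\<Sum>k. \<beta>^(k + Suc K) * w (k + Suc K)\<bar> \<le> (\<Sum>k. \<beta>^(k + Suc K))"
      using norm_suminf_le[OF _ s, of "\<lambda>k. \<beta>^(k + Suc K) * w (k + Suc K)"] w1 b
      by (simp add: abs_mult mult_left_le)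
    also have "\<dots> = \<beta>^Suc K * (1 / (1 - \<beta>))"
      using suminf_mult[OF geo, of "\<beta>^Suc K"] suminf_geometric[of \<beta>] b
      by (simp add: power_add ac_simps)
    also have "\<dots> \<le> \<beta>^Suc K * 2" using b by (intro mult_left_mono) (auto simp: field_simps)
    finally show ?thesis by simp
  qed
  have "\<bar>\<Sum>k<n. \<beta>^k * w k\<bar> \<le> 2 * \<beta> * (d / \<beta>^n)" for n
  proof (induction n)
    case 0
    have "0 \<le> d" using uv[of 0] by auto
    then show ?case using b by simp
  next
    case (Suc n)
    have d: "0 \<le> d" using uv[of 0] by auto
    have "\<bar>\<beta>^n * w n\<bar> \<le> \<beta>^n * (d / (\<beta>^n)\<^sup>2)"
      unfolding abs_mult w_def using b uv[of n] by (intro mult_mono) auto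
    also have "\<dots> = d / \<beta>^n" using b by (simp add: power2_eq_square)
    finally have "\<bar>\<Sum>k<Suc n. \<beta>^k * w k\<bar> \<le> 2 * \<beta> * (d / \<beta>^n) + d / \<beta>^n" using Suc by simp
    also have "\<dots> = (2 * \<beta> + 1) * (d / \<beta>^n)" by (simp add: algebra_simps)
    also have "\<dots> \<le> 2 * (d / \<beta>^n)"
      using b d by (intro mult_right_mono) auto
    also have "\<dots> = 2 * \<beta> * (d / \<beta>^Suc n)" using b by simp
    finally show ?case .
  qed
  note head = this[of K]
  show ?thesis
    unfolding eq w_def[symmetric] split distrib_left
    using abs_triangle_ineq[of "\<Sum>k. \<beta>^(k + Suc K) * w (k + Suc K)" "\<Sum>k<K. \<beta>^k * w k"]
      tail head by linarith
qed

text \<open>The coordinate \<open>F x c\<close> of the light map collects the tents of the family with index \<open>c\<close> at all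
  scales. For lightness at radius \<open>r\<close>, the level \<open>K\<close> with \<open>\<beta> * \<beta>\<^sup>K \<le> 2 * r < \<beta>\<^sup>K\<close> is used: a
  chain of small steps that leaves the neighbourhood of a set of the family changes the tent of
  level \<open>K\<close> from \<open>1\<close> to \<open>0\<close> and hence \<open>F\<close> by at least \<open>\<beta>\<^sup>K / 2\<close>, which exceeds \<open>r\<close>.\<close>

theorem Lipschitz_dim_sqrt_metric_le:
  fixes X :: "'a metric"
  assumes bounded: "\<And>x y. x \<in> mspace X \<Longrightarrow> y \<in> mspace X \<Longrightarrow> mdist X x y \<le> R"
    and D: "0 \<le> D"
    and covers: "\<And>s. 0 < s \<Longrightarrow> \<exists>\<U>. separated_cover X M s (D * s) \<U>"
  shows "Lipschitz_dim (sqrt_metric X) \<le> enat M"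
proof -
  \<comment> \<open>Below, points at distance at most \<open>(3 * D + 2) * \<beta>\<^sup>2\<^sup>K\<close> are compared at level \<open>K\<close>; this choice makes
    the error \<open>2 * \<beta> * (3 * D + 3) * \<beta>\<^sup>K\<close> from the other levels equal to half of \<open>\<beta>\<^sup>K\<close>.\<close>
  define \<beta> :: real where "\<beta> = 1 / (12 * (D + 1))"
  have b: "0 < \<beta>" "\<beta> \<le> 1/2" and bD: "12 * (D + 1) * \<beta> = 1"
    using D by (auto simp: \<beta>_def divide_simps)
  define s where "s k = (\<beta>^k)\<^sup>2" for k
  have s0: "0 < s k" for k using b by (simp add: s_def)
  \<comment> \<open>The gap \<open>3 * s k\<close> leaves room for one step of a chain and for the passage from its two ends to
    points of the family.\<close>
  have "\<forall>k. \<exists>\<U>. separated_cover X M (3 * s k) (D * (3 * s k)) \<U>"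
    using covers s0 by simp
  then obtain \<U> where \<U>: "separated_cover X M (3 * s k) (D * (3 * s k)) (\<U> k)" for k
    by metis
  have U_sub: "\<Union>(\<U> k c) \<subseteq> mspace X" if "c < M" for k c
    using \<U>[of k] that by (simp add: separated_cover_def)
  have U_cov: "\<exists>c<M. \<exists>A\<in>\<U> k c. x \<in> A" if "x \<in> mspace X" for k x
    using \<U>[of k] that unfolding separated_cover_def by blast
  have U_sep: "A = B" if "c < M" "A \<in> \<U> k c" "B \<in> \<U> k c" "a \<in> A" "b \<in> B" "mdist X a b \<le> 3 * s k"
    for k c A B a b
    using \<U>[of k] that unfolding separated_cover_def by blast
  have U_diam: "mdist X a b \<le> D * (3 * s k)" if "c < M" "A \<in> \<U> k c" "a \<in> A" "b \<in> A" for k c A a b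
    using \<U>[of k] that unfolding separated_cover_def by blast
  define \<phi> where "\<phi> c x k = tent X (s k) (\<Union>(\<U> k c)) x" for c x k
  have \<phi>01: "0 \<le> \<phi> c z k" "\<phi> c z k \<le> 1" for c z k
    unfolding \<phi>_def by (rule tent_nonneg[OF s0] tent_le_1[OF s0])+
  define F where "F x c = (if c < M then \<Sum>k. \<beta>^k * \<phi> c x k else 0)" for x c
  have F_est: "\<bar>F x c - F y c - \<beta>^K * (\<phi> c x K - \<phi> c y K)\<bar>
                 \<le> 2 * \<beta> * (mdist X x y / \<beta>^K + \<beta>^K)"
    if "c < M" "x \<in> mspace X" "y \<in> mspace X" for c x y K
  proof -
    have "\<bar>\<phi> c x k - \<phi> c y k\<bar> \<le> mdist X x y / (\<beta>^k)\<^sup>2" for k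
      using tent_Lipschitz[OF s0[of k] U_sub[OF that(1)] that(2,3)] unfolding \<phi>_def s_def .
    from geometric_sum_dominated_at_one_scale[OF b \<phi>01 \<phi>01 this] show ?thesis
      using that(1) by (simp add: F_def)
  qed

  have F_Lip: "\<bar>F x c - F y c\<bar> \<le> (3 / \<beta>) * sqrt (mdist X x y)"
    if c: "c < M" and xy: "x \<in> mspace X" "y \<in> mspace X" for c x y
  proof -
    define \<rho> where "\<rho> = sqrt (mdist X x y)"
    have d: "mdist X x y = \<rho>\<^sup>2" and \<rho>0: "0 \<le> \<rho>" by (auto simp: \<rho>_def)
    consider "\<rho> = 0" | "1 < \<rho>" | "0 < \<rho>" "\<rho> \<le> 1" using \<rho>0 by linarith
    then have "\<bar>F x c - F y c\<bar> \<le> (3 / \<beta>) * \<rho>"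
    proof cases
      case 1
      then have "x = y" using d xy by simp
      then show ?thesis using 1 by simp
    next
      case 2
      have s': "summable (\<lambda>k. \<beta>^k)" using b by (simp add: summable_geometric)
      have bd: "0 \<le> F z c \<and> F z c \<le> 2" for z
      proof -
        have s'': "summable (\<lambda>k. \<beta>^k * \<phi> c z k)"
          by (rule summable_comparison_test'[OF s', of 0])
             (use b \<phi>01 in \<open>simp add: abs_mult mult_left_le\<close>)
        have "0 \<le> (\<Sum>k. \<beta>^k * \<phi> c z k)"
          using b \<phi>01 by (intro suminf_nonneg s'') simp
        moreover have "(\<Sum>k. \<beta>^k * \<phi> c z k) \<le> (\<Sum>k. \<beta>^k)"
          using b \<phi>01 by (intro suminf_le s' s'') (simp add: mult_left_le)
        moreover have "(\<Sum>k. \<beta>^k) = 1 / (1 - \<beta>)" using b by (intro suminf_geometric) simp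
        moreover have "1 / (1 - \<beta>) \<le> 2" using b by (simp add: field_simps)
        ultimately show ?thesis using c by (simp add: F_def)
      qed
      have "\<bar>F x c - F y c\<bar> \<le> 2" using bd[of x] bd[of y] by linarith
      also have "2 \<le> 3 * 1 * \<rho>" using 2 by simp
      also have "\<dots> \<le> (3 / \<beta>) * \<rho>"
        using b 2 by (intro mult_right_mono) (auto simp: field_simps)
      finally show ?thesis .
    next
      case 3
      obtain K where K: "\<beta>^Suc K < \<rho>" "\<rho> \<le> \<beta>^K"
      proof -
        have "\<exists>n. \<beta>^n < \<rho>" using 3 b by (intro real_arch_pow_inv) auto
        define n where "n = (LEAST n. \<beta>^n < \<rho>)"
        have n: "\<beta>^n < \<rho>" unfolding n_def using \<open>\<exists>n. \<beta>^n < \<rho>\<close> by (rule LeastI_ex)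
        have "n \<noteq> 0" using n 3 by (intro notI) simp
        then obtain K where K: "n = Suc K" by (cases n) auto
        then have "\<not> \<beta>^K < \<rho>" unfolding n_def by (intro not_less_Least) (simp add: n_def)
        then show ?thesis using that n K by auto
      qed
      have bK: "0 < \<beta>^K" using b by simp
      have q: "\<rho>\<^sup>2 / \<beta>^K \<le> \<rho>"
        using K(2) bK 3 by (simp add: divide_simps power2_eq_square)
      have "\<bar>\<beta>^K * (\<phi> c x K - \<phi> c y K)\<bar> \<le> \<beta>^K * (\<rho>\<^sup>2 / s K)"
        unfolding abs_mult \<phi>_def
        using tent_Lipschitz[OF s0[of K] U_sub[OF c] xy] bK d by (intro mult_mono) auto
      also have "\<dots> = \<rho>\<^sup>2 / \<beta>^K" using b by (simp add: s_def power2_eq_square)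
      also note q
      finally have 1: "\<bar>\<beta>^K * (\<phi> c x K - \<phi> c y K)\<bar> \<le> \<rho>" .
      have "2 * \<beta> * (\<rho>\<^sup>2 / \<beta>^K + \<beta>^K) \<le> 2 * \<beta> * (\<rho> + \<beta>^K)"
        using b q by (intro mult_left_mono) auto
      also have "\<dots> = 2 * \<beta> * \<rho> + 2 * \<beta>^Suc K" by (simp add: algebra_simps)
      also have "\<dots> \<le> \<rho> + 2 * \<rho>"
        using b 3 K mult_right_mono[of "2 * \<beta>" 1 \<rho>] by (intro add_mono) auto
      finally have "\<bar>F x c - F y c\<bar> \<le> 4 * \<rho>"
        using F_est[OF c xy, of K] 1 unfolding d by linarith
      also have "4 * \<rho> \<le> (3 / \<beta>) * \<rho>"
        using b 3 by (intro mult_right_mono) (auto simp: field_simps)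
      finally show ?thesis .
    qed
    then show ?thesis by (simp add: \<rho>_def)
  qed

  have F_light: "sqrt (mdist X x y) \<le> (2 * sqrt \<bar>R\<bar> + sqrt (3 * D + 1) * (2 / \<beta>)) * r"
    if r: "0 < r" and S: "S \<subseteq> mspace X" and x: "x \<in> S"
      and FS: "\<And>c u v. c < M \<Longrightarrow> u \<in> S \<Longrightarrow> v \<in> S \<Longrightarrow> \<bar>F u c - F v c\<bar> \<le> r"
      and chain: "(\<lambda>u v. u \<in> S \<and> v \<in> S \<and> sqrt (mdist X u v) \<le> r)\<^sup>*\<^sup>* x y"
    for r S x y
  proof (cases "1/2 \<le> r")
    case True
    have "y \<in> S" using chain x by (induction rule: rtranclp_induct) auto
    then have "mdist X x y \<le> R" using bounded x S by blast
    then have "mdist X x y \<le> \<bar>R\<bar>" by simp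
    then have "sqrt (mdist X x y) \<le> sqrt \<bar>R\<bar>" by simp
    also have "\<dots> \<le> sqrt \<bar>R\<bar> * (2 * r)" using True by (simp add: mult_le_cancel_left1)
    also have "\<dots> \<le> (2 * sqrt \<bar>R\<bar> + sqrt (3 * D + 1) * (2 / \<beta>)) * r"
      using b D r by (simp add: algebra_simps)
    finally show ?thesis .
  next
    case False
    obtain K where K: "\<beta>^Suc K \<le> 2 * r" "2 * r < \<beta>^K"
    proof -
      have ex: "\<exists>n. \<beta>^n \<le> 2 * r"
        using r b real_arch_pow_inv[of "2 * r" \<beta>] by (auto intro: less_imp_le)
      define n where "n = (LEAST n. \<beta>^n \<le> 2 * r)"
      have n: "\<beta>^n \<le> 2 * r" unfolding n_def using ex by (rule LeastI_ex)
      have "n \<noteq> 0" using n False by (intro notI) simp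
      then obtain K where K: "n = Suc K" by (cases n) auto
      then have "\<not> \<beta>^K \<le> 2 * r" unfolding n_def by (intro not_less_Least) (simp add: n_def)
      then show ?thesis using that n K by auto
    qed
    have bK: "0 < \<beta>^K" using b by simp
    have r2: "r\<^sup>2 \<le> s K" unfolding s_def using K r by (intro power_mono) auto
    obtain c A where c: "c < M" and A: "A \<in> \<U> K c" "x \<in> A" using U_cov[of x K] x S by blast
    \<comment> \<open>The chain cannot move away from \<open>A\<close>: as long as it is near \<open>A\<close>, its next point is so close to \<open>x\<close>
      that a vanishing tent of level \<open>K\<close> would show in \<open>F\<close>, and by separation the set of the family near
      the next point is again \<open>A\<close>.\<close>
    have near: "y \<in> S \<and> (\<exists>a\<in>A. mdist X y a < s K)"
      using chain
    proof (induction rule: rtranclp_induct)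
      case base
      have "mdist X x x = 0" using x S by auto
      then show ?case using x A s0[of K] by (intro conjI bexI[of _ x]) auto
    next
      case (step y z)
      then obtain a where a: "a \<in> A" "mdist X y a < s K" and yz: "y \<in> S" "z \<in> S" by blast
      have "sqrt (mdist X y z) \<le> r" using step by blast
      then have "mdist X y z \<le> r\<^sup>2" by (rule sqrt_le_D)
      with r2 have dyz: "mdist X y z \<le> s K" by linarith
      have aX: "a \<in> mspace X" using U_sub[OF c, of K] A a by blast
      have xyz: "x \<in> mspace X" "y \<in> mspace X" "z \<in> mspace X" using x yz S by auto
      have "mdist X x a \<le> D * (3 * s K)" using U_diam[OF c A(1) A(2) a(1)] .
      moreover have "mdist X x z \<le> mdist X x a + mdist X a y + mdist X y z"
        using mdist_triangle[OF xyz(1) aX xyz(3)] mdist_triangle[OF aX xyz(2,3)] by linarith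
      ultimately have dxz: "mdist X x z \<le> (3 * D + 2) * s K"
        using a dyz by (simp add: mdist_commute algebra_simps)
      have "0 < \<phi> c z K"
      proof (rule ccontr)
        assume "\<not> 0 < \<phi> c z K"
        then have z0: "\<phi> c z K = 0" using tent_nonneg[OF s0, of X K "\<Union>(\<U> K c)" z] by (simp add: \<phi>_def)
        have "x \<in> \<Union>(\<U> K c)" "x \<in> mspace X" using A x S by auto
        then have x1: "\<phi> c x K = 1" unfolding \<phi>_def by (rule tent_eq_1[OF s0])
        have "mdist X x z / \<beta>^K \<le> ((3 * D + 2) * s K) / \<beta>^K"
          using dxz bK by (intro divide_right_mono) auto
        also have "\<dots> = (3 * D + 2) * \<beta>^K" using bK by (simp add: s_def power2_eq_square)
        finally have "2 * \<beta> * (mdist X x z / \<beta>^K + \<beta>^K) \<le> 2 * \<beta> * ((3 * D + 2) * \<beta>^K + \<beta>^K)"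
          using b by (intro mult_left_mono) auto
        also have "\<dots> = (12 * (D + 1) * \<beta>) * (\<beta>^K / 2)" by (simp add: algebra_simps)
        also have "\<dots> = \<beta>^K / 2" unfolding bD by simp
        finally have "\<bar>F x c - F z c - \<beta>^K\<bar> \<le> \<beta>^K / 2"
          using F_est[OF c xyz(1,3), of K] unfolding z0 x1 by simp
        moreover have "\<bar>F x c - F z c\<bar> \<le> r" using FS[OF c x yz(2)] .
        ultimately show False using K(2) by linarith
      qed
      then have "\<exists>a'\<in>\<Union>(\<U> K c). mdist X z a' < s K"
        unfolding \<phi>_def by (rule tent_pos_imp_near[OF s0])
      then obtain a' B where a': "B \<in> \<U> K c" "a' \<in> B" "mdist X z a' < s K"
        by blast
      have a'X: "a' \<in> mspace X" using U_sub[OF c, of K] a' by blast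
      have "mdist X a a' \<le> mdist X a y + mdist X y z + mdist X z a'"
        using mdist_triangle[OF aX xyz(2) a'X] mdist_triangle[OF xyz(2,3) a'X] by linarith
      then have "mdist X a a' \<le> 3 * s K" using a a' dyz by (simp add: mdist_commute)
      then have "A = B" using U_sep[OF c A(1) a'(1) a(1) a'(2)] by blast
      then show ?case using a' yz by blast
    qed
    then obtain a where a: "a \<in> A" "mdist X y a < s K" and y: "y \<in> S" by blast
    have aX: "a \<in> mspace X" using U_sub[OF c, of K] A a by blast
    have xy: "x \<in> mspace X" "y \<in> mspace X" using x y S by auto
    have "mdist X x y \<le> D * (3 * s K) + s K"
      using mdist_triangle[OF xy(1) aX xy(2)] U_diam[OF c A(1) A(2) a(1)] a(2)
      by (simp add: mdist_commute)
    also have "\<dots> = (3 * D + 1) * (\<beta>^K)\<^sup>2" by (simp add: s_def algebra_simps)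
    finally have "sqrt (mdist X x y) \<le> sqrt ((3 * D + 1) * (\<beta>^K)\<^sup>2)" by simp
    also have "\<dots> = sqrt (3 * D + 1) * \<beta>^K" using bK by (simp add: real_sqrt_mult)
    also have "\<dots> \<le> sqrt (3 * D + 1) * (2 / \<beta> * r)"
      using K(1) b D by (intro mult_left_mono) (auto simp: field_simps)
    also have "\<dots> \<le> (2 * sqrt \<bar>R\<bar> + sqrt (3 * D + 1) * (2 / \<beta>)) * r"
      using b D r by (simp add: algebra_simps)
    finally show ?thesis .
  qed

  define C1 where "C1 = 2 * sqrt \<bar>R\<bar> + sqrt (3 * D + 1) * (2 / \<beta>)"
  define C where "C = real M * (3 / \<beta>) + 2 * C1"
  have C1: "0 < C1" unfolding C1_def using b D by (intro add_nonneg_pos mult_pos_pos) auto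
  have C0: "0 < C" unfolding C_def using b C1 by (intro add_nonneg_pos) auto
  have "Lipschitz_light (sqrt_metric X) (Euclidean_metric M) F"
    unfolding Lipschitz_light_def
  proof (intro conjI exI[of _ C] C0 ballI allI impI)
    show "F \<in> mspace (sqrt_metric X) \<rightarrow> mspace (Euclidean_metric M)" by (auto simp: F_def)
  next
    fix x y assume "x \<in> mspace (sqrt_metric X)" "y \<in> mspace (sqrt_metric X)"
    then have xy: "x \<in> mspace X" "y \<in> mspace X" by auto
    have "L2_set (\<lambda>i. F x i - F y i) {..<M} \<le> (\<Sum>i<M. \<bar>F x i - F y i\<bar>)"
      by (rule L2_set_le_sum_abs)
    also have "\<dots> \<le> (\<Sum>i<M. (3 / \<beta>) * sqrt (mdist X x y))"
      using xy by (intro sum_mono F_Lip) auto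
    also have "\<dots> = real M * (3 / \<beta>) * sqrt (mdist X x y)" by simp
    also have "\<dots> \<le> C * sqrt (mdist X x y)"
      using C1 by (intro mult_right_mono) (auto simp: C_def)
    finally show "mdist (Euclidean_metric M) (F x) (F y) \<le> C * mdist (sqrt_metric X) x y" by simp
  next
    fix r :: real and W K
    assume r: "0 < r" and W: "W \<subseteq> mspace (Euclidean_metric M)"
      and diam: "mdiameter (Euclidean_metric M) W \<le> ennreal r"
      and K: "K \<in> r_components (submetric (sqrt_metric X) (F -` W)) r"
    define S where "S = F -` W \<inter> mspace X"
    obtain x where x: "x \<in> S"
      and Kx: "K = {y. same_r_component (submetric (sqrt_metric X) (F -` W)) r x y}"
      using K unfolding r_components_def by (auto elim!: quotientE simp: S_def)
    have FS: "\<bar>F u c - F v c\<bar> \<le> r" if "c < M" "u \<in> S" "v \<in> S" for c u v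
    proof -
      have "\<bar>F u c - F v c\<bar> \<le> L2_set (\<lambda>i. \<bar>F u i - F v i\<bar>) {..<M}"
        using that by (intro member_le_L2_set[where f = "\<lambda>i. \<bar>F u i - F v i\<bar>"]) auto
      also have "\<dots> = mdist (Euclidean_metric M) (F u) (F v)" by (simp add: L2_set_def)
      also have "\<dots> \<le> r"
        using diam that r unfolding mdiameter_le_iff[OF less_imp_le[OF r]] S_def by blast
      finally show ?thesis .
    qed
    have dist: "sqrt (mdist X x y) \<le> C1 * r \<and> y \<in> S" if "y \<in> K" for y
    proof -
      have "(\<lambda>u v. u \<in> S \<and> v \<in> S \<and> sqrt (mdist X u v) \<le> r)\<^sup>*\<^sup>* x y"
        using same_r_component_imp_rtranclp[of "submetric (sqrt_metric X) (F -` W)" r x y] that Kx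
        by (simp add: S_def)
      moreover from this have "y \<in> S" using x by (induction rule: rtranclp_induct) auto
      ultimately show ?thesis
        using F_light[OF r _ x FS] unfolding C1_def by (simp add: S_def)
    qed
    show "mdiameter (sqrt_metric X) K \<le> ennreal (C * r)"
    proof (subst mdiameter_le_iff)
      show "0 \<le> C * r" using C0 r by simp
      show "\<forall>y\<in>K. \<forall>z\<in>K. mdist (sqrt_metric X) y z \<le> C * r"
      proof (intro ballI)
        fix y z assume yz: "y \<in> K" "z \<in> K"
        have "mdist (sqrt_metric X) y z \<le> mdist (sqrt_metric X) x y + mdist (sqrt_metric X) x z"
          using mdist_triangle[of y "sqrt_metric X" x z] dist[OF yz(1)] dist[OF yz(2)] x
          by (simp add: S_def mdist_commute)
        also have "\<dots> \<le> 2 * C1 * r" using dist[OF yz(1)] dist[OF yz(2)] by simp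
        also have "\<dots> \<le> C * r" using r b by (intro mult_right_mono) (auto simp: C_def)
        finally show "mdist (sqrt_metric X) y z \<le> C * r" .
      qed
    qed
  qed
  then show ?thesis
    unfolding Lipschitz_dim_def by (intro INF_lower) auto
qed

section \<open>Vertices and edges of the substitution space\<close>

text \<open>An edge is given by its address, innermost choice first: \<open>(u, q) # e\<close> is the half of the edge \<open>e\<close>
  that joins the midpoint of \<open>e\<close> with parameter \<open>q\<close> to the end of \<open>e\<close> on side \<open>u\<close> (\<open>True\<close> for the upper
  side). The edge \<open>[]\<close> joins the two vertices \<open>Apex True\<close> and \<open>Apex False\<close>. Thus an edge lies inside
  another one precisely if its address has the address of the other one as a suffix.\<close>

type_synonym edge = "(bool \<times> rat) list"

datatype vertex = Apex bool | Mid edge rat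

instance vertex :: countable
  by countable_datatype

definition edge_length :: "edge \<Rightarrow> real" where
  "edge_length e = (1/2) ^ length e"

fun endpoint :: "bool \<Rightarrow> edge \<Rightarrow> vertex" where
  "endpoint u [] = Apex u"
| "endpoint u ((v, q) # e) = (if u = v then endpoint u e else Mid e q)"

definition sgn_of :: "bool \<Rightarrow> real" where
  "sgn_of u = (if u then 1 else -1)"

text \<open>All midpoints of an edge are at the same height, and an edge \<open>e\<close> covers the heights from
  \<open>mid_height e - edge_length e / 2\<close> to \<open>mid_height e + edge_length e / 2\<close>; the root edge is centred at \<open>0\<close>.\<close>

fun mid_height :: "edge \<Rightarrow> real" where
  "mid_height [] = 0"
| "mid_height ((u, q) # e) = mid_height e + sgn_of u * edge_length e / 4"

fun height :: "vertex \<Rightarrow> real" where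
  "height (Apex u) = sgn_of u / 2"
| "height (Mid e q) = mid_height e"

text \<open>The distance on the vertices is the largest one that respects prescribed upper bounds between
  the midpoints of an edge and its ends and among the midpoints. It is defined by duality, as the
  supremum of \<open>\<bar>g x - g y\<bar>\<close> over the functions \<open>g\<close> that are compatible with these bounds. So upper
  bounds for the distance need only chains of prescribed bounds, lower bounds only a suitable
  function, and the triangle inequality is automatic.\<close>

definition short_maps :: "(vertex \<Rightarrow> real) set" where
  "short_maps = {g. \<forall>e p. (\<forall>u. \<bar>g (endpoint u e) - g (Mid e p)\<bar> \<le> edge_length e / 2) \<and>
                          (\<forall>q. \<bar>g (Mid e p) - g (Mid e q)\<bar> \<le> edge_length e * \<bar>real_of_rat p - real_of_rat q\<bar>)}"

definition vdist :: "vertex \<Rightarrow> vertex \<Rightarrow> real" where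
  "vdist x y = (SUP g\<in>short_maps. \<bar>g x - g y\<bar>)"

text \<open>\<open>branch f x\<close> tells whether the vertex \<open>x\<close> lies in the interior of the edge \<open>f\<close>, and if so, through
  which midpoint of \<open>f\<close> the vertex hangs on \<open>f\<close>: it is \<open>Some q\<close> if \<open>x\<close> is \<open>Mid f q\<close> or lies in the interior
  of a half of \<open>f\<close> ending in \<open>Mid f q\<close> (see \<open>branch_iff\<close>).\<close>

function (sequential) branch :: "edge \<Rightarrow> vertex \<Rightarrow> rat option" where
  "branch f (Apex u) = None"
| "branch f (Mid [] p) = (if f = [] then Some p else None)"
| "branch f (Mid ((u, q) # e) p) = (if f = (u, q) # e then Some p else branch f (Mid e q))"
  by pat_completeness auto
termination
  by (relation "Wellfounded.measure (\<lambda>(f, x). case x of Apex u \<Rightarrow> 0 | Mid e q \<Rightarrow> length e)") auto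

lemma edge_length_simps [simp]:
  "edge_length [] = 1" "edge_length (x # e) = edge_length e / 2"
  by (simp_all add: edge_length_def)

lemma edge_length_pos [simp]: "0 < edge_length e"
  by (simp add: edge_length_def)

lemma edge_length_nonneg [simp]: "0 \<le> edge_length e" "\<bar>edge_length e\<bar> = edge_length e"
  by (simp_all add: edge_length_def)

lemma sgn_of_simps [simp]: "sgn_of True = 1" "sgn_of False = -1"
  by (simp_all add: sgn_of_def)

lemma height_endpoint: "height (endpoint u e) = mid_height e + sgn_of u * edge_length e / 2"
proof (induction e)
  case (Cons a e)
  then show ?case by (cases a; cases u; cases "fst a") (auto simp: field_simps)
qed simp

lemma branch_Mid_same [simp]: "branch e (Mid e p) = Some p"
  by (cases e rule: list.exhaust) auto

lemma branch_iff:
  "branch f (Mid e p) = Some q \<longleftrightarrow> (e = f \<and> p = q) \<or> (\<exists>w u. e = w @ (u, q) # f)"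
proof (induction e arbitrary: p)
  case Nil
  then show ?case by auto
next
  case (Cons a e)
  obtain v t where a: "a = (v, t)" by (cases a)
  show ?case
  proof (cases "f = a # e")
    case True
    have "\<not> (\<exists>w u. a # e = w @ (u, q) # f)"
      using True by (auto dest!: arg_cong[where f = length])
    then show ?thesis using True a by auto
  next
    case False
    then show ?thesis using Cons[of t] a
      by (auto simp: Cons_eq_append_conv)
  qed
qed

lemma branch_suffix: "branch f (Mid e p) \<noteq> None \<longleftrightarrow> suffix f e"
proof
  assume "branch f (Mid e p) \<noteq> None"
  then show "suffix f e" using branch_iff[of f e p] by (auto simp: suffix_def)
next
  assume "suffix f e"
  then obtain w where w: "e = w @ f" by (auto simp: suffix_def)
  show "branch f (Mid e p) \<noteq> None"
  proof (cases w rule: rev_cases)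
    case Nil
    then show ?thesis using w by simp
  next
    case (snoc w' a)
    obtain u q where "a = (u, q)" by (cases a)
    then have "branch f (Mid e p) = Some q" using branch_iff[of f e p q] w snoc by auto
    then show ?thesis by simp
  qed
qed

text \<open>The end of \<open>e\<close> on side \<open>u\<close> is passed on from edge to half as long as the half is the one on side \<open>u\<close>;
  it is therefore a midpoint of the innermost edge in whose opposite half \<open>e\<close> lies, and an apex if there
  is no such edge.\<close>

lemma endpoint_cases:
  "endpoint u e = Apex u \<or> (\<exists>w f q. endpoint u e = Mid f q \<and> e = w @ (\<not> u, q) # f)"
proof (induction e)
  case (Cons a e)
  obtain v t where a: "a = (v, t)" by (cases a)
  show ?case
  proof (cases "u = v")
    case True
    with Cons a show ?thesis by (metis append_Cons endpoint.simps(2))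
  next
    case False
    with a show ?thesis by (intro disjI2 exI[of _ "[]"] exI[of _ e] exI[of _ t]) auto
  qed
qed simp

lemma branch_own_endpoint: "branch e (endpoint u e) = None"
proof (rule ccontr)
  assume *: "branch e (endpoint u e) \<noteq> None"
  then obtain w f q where "endpoint u e = Mid f q" "e = w @ (\<not> u, q) # f"
    using endpoint_cases[of u e] by auto
  then show False using * branch_suffix[of e f q] by (auto dest: suffix_length_le)
qed

text \<open>An edge that meets the interior of \<open>f\<close> can leave \<open>f\<close> only through an end of \<open>f\<close>. This makes
  functions supported in the interior of \<open>f\<close> compatible with the prescribed bounds as soon as they
  tend to \<open>0\<close> at the ends.\<close>

lemma branch_endpoint:
  "branch f (endpoint u e) = branch f (Mid e p) \<or>
   (endpoint u e = endpoint u f \<and> branch f (endpoint u e) = None)"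
proof (induction e arbitrary: p)
  case (Cons a e)
  obtain v t where a: "a = (v, t)" by (cases a)
  show ?case
  proof (cases "f = a # e")
    case True
    then show ?thesis using branch_own_endpoint[of f u] by metis
  next
    case False
    then show ?thesis using Cons[of t] a by auto
  qed
qed auto

section \<open>The distance on the vertices\<close>

lemma short_endpoint_step:
  assumes "g \<in> short_maps"
  shows "\<bar>g (endpoint u e) - g (Mid e p)\<bar> \<le> edge_length e / 2"
  using assms by (simp add: short_maps_def)

lemma short_path_step:
  assumes "g \<in> short_maps"
  shows "\<bar>g (Mid e p) - g (Mid e q)\<bar> \<le> edge_length e * \<bar>real_of_rat p - real_of_rat q\<bar>"
  using assms by (simp add: short_maps_def)

lemma sgn_of_square [simp]: "sgn_of u * (sgn_of u * r) = r" "sgn_of u * sgn_of u = 1"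
  by (cases u; simp)+

lemma sgn_of_not [simp]: "sgn_of (\<not> u) = - sgn_of u"
  by (cases u) auto

text \<open>Going up or down along nested edges is monotone in height, so the prescribed bounds add up to the
  difference of heights.\<close>

lemma short_endpoints:
  assumes g: "g \<in> short_maps" and "suffix f e"
  shows "\<bar>g (endpoint u e) - g (endpoint u f)\<bar>
           \<le> sgn_of u * (height (endpoint u f) - height (endpoint u e))"
  using assms(2)
proof (induction e)
  case (Cons a e)
  obtain v t where a: "a = (v, t)" by (cases a)
  show ?case
  proof (cases "f = a # e \<or> v = u")
    case True
    then show ?thesis using Cons a by (auto simp: suffix_Cons)
  next
    case False
    then have "suffix f e" using Cons.prems by (auto simp: suffix_Cons)
    note IH = Cons.IH[OF this]
    have "sgn_of u * (height (endpoint u e) - height (Mid e t)) = edge_length e / 2"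
      by (simp add: height_endpoint algebra_simps)
    moreover have Mid: "endpoint u (a # e) = Mid e t" using a False by auto
    ultimately show ?thesis
      using IH short_endpoint_step[OF g, of u e t] unfolding Mid right_diff_distrib by linarith
  qed
qed simp

lemma short_endpoint:
  assumes g: "g \<in> short_maps" and "branch f x \<noteq> None"
  shows "\<bar>g x - g (endpoint u f)\<bar> \<le> sgn_of u * (height (endpoint u f) - height x)"
proof -
  obtain e p where x: "x = Mid e p" using assms(2) by (cases x) auto
  then have "suffix f e" using assms(2) branch_suffix by simp
  moreover have "sgn_of u * (height (endpoint u e) - height x) = edge_length e / 2"
    by (simp add: height_endpoint x algebra_simps)
  ultimately show ?thesis
    using short_endpoints[OF g, of f e u] short_endpoint_step[OF g, of u e p]
    unfolding x right_diff_distrib by linarith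
qed

lemma short_branch:
  assumes g: "g \<in> short_maps" and br: "branch f x = Some q"
  shows "\<bar>g x - g (Mid f q)\<bar> \<le> \<bar>height x - mid_height f\<bar>"
proof -
  obtain e p where x: "x = Mid e p" using br by (cases x) auto
  from br[unfolded x branch_iff] show ?thesis
  proof (elim disjE exE conjE)
    assume "e = f" "p = q"
    then show ?thesis by (simp add: x)
  next
    fix w u assume e: "e = w @ (u, q) # f"
    have "branch ((u, q) # f) x \<noteq> None" unfolding x branch_suffix e by (simp add: suffix_def)
    moreover have "endpoint (\<not> u) ((u, q) # f) = Mid f q" by simp
    ultimately show ?thesis
      using short_endpoint[OF g, of "(u, q) # f" x "\<not> u"] by (cases u) auto
  qed
qed

lemma zero_short: "(\<lambda>_. 0) \<in> short_maps"
  by (simp add: short_maps_def less_imp_le)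

text \<open>Although this is a statement about heights, it is the positivity of the right hand side in
  \<open>short_endpoints\<close>, read off from the zero function.\<close>

lemma mid_height_within:
  assumes "suffix f e"
  shows "\<bar>mid_height e - mid_height f\<bar> \<le> edge_length f / 2 - edge_length e / 2"
  using short_endpoints[OF zero_short assms, of True] short_endpoints[OF zero_short assms, of False]
  by (simp add: height_endpoint)

lemma mid_height_gap:
  assumes "suffix ((u, q) # f) e"
  shows "edge_length e / 2 \<le> \<bar>mid_height e - mid_height f\<bar>"
  using mid_height_within[OF assms] by (cases u) (auto simp: abs_if split: if_splits)

lemma short_Apex:
  assumes g: "g \<in> short_maps"
  shows "\<bar>g x - g (Apex u)\<bar> \<le> sgn_of u * (height (Apex u) - height x)"
proof (cases x)
  case (Apex v)
  have "\<bar>g (Apex True) - g (Apex False)\<bar> \<le> 1"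
    using short_endpoint_step[OF g, of True "[]" 0] short_endpoint_step[OF g, of False "[]" 0]
    unfolding endpoint.simps edge_length_simps by linarith
  then show ?thesis using Apex by (cases u; cases v) (auto simp: abs_minus_commute)
next
  case (Mid e p)
  then have "branch [] x \<noteq> None" by (simp only: branch_suffix) simp
  from short_endpoint[OF g this, of u] show ?thesis by simp
qed

lemma short_bounded:
  assumes g: "g \<in> short_maps"
  shows "\<bar>g x - g y\<bar> \<le> 2"
proof -
  have h: "\<bar>height z\<bar> \<le> 1/2" for z
    using short_Apex[OF zero_short, of True z] short_Apex[OF zero_short, of False z] by simp
  show ?thesis
    using short_Apex[OF g, of x True] short_Apex[OF g, of y True] h[of x] h[of y] by simp
qed

lemma vdist_least: "(\<And>g. g \<in> short_maps \<Longrightarrow> \<bar>g x - g y\<bar> \<le> c) \<Longrightarrow> vdist x y \<le> c"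
  unfolding vdist_def using zero_short by (intro cSUP_least) auto

lemma vdist_upper: "g \<in> short_maps \<Longrightarrow> \<bar>g x - g y\<bar> \<le> vdist x y"
  unfolding vdist_def using short_bounded by (intro cSUP_upper bdd_aboveI2[of _ _ 2]) auto

lemma vdist_le_2: "vdist x y \<le> 2"
  using short_bounded by (rule vdist_least)

text \<open>The test functions for lower bounds: supported in the interior of \<open>f\<close>, prescribed by \<open>\<psi>\<close> on the
  midpoints of \<open>f\<close> and decreasing with slope \<open>1\<close> in height away from them. The bound on \<open>\<psi>\<close> in
  \<open>bump_short\<close> lets them vanish at the ends of \<open>f\<close>.\<close>

definition bump :: "edge \<Rightarrow> (rat \<Rightarrow> real) \<Rightarrow> vertex \<Rightarrow> real" where
  "bump f \<psi> x =
     (case branch f x of None \<Rightarrow> 0 | Some q \<Rightarrow> max 0 (\<psi> q - \<bar>height x - mid_height f\<bar>))"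

lemma bump_short:
  assumes lip: "\<And>p q. \<bar>\<psi> p - \<psi> q\<bar> \<le> edge_length f * \<bar>real_of_rat p - real_of_rat q\<bar>"
    and le: "\<And>q. \<psi> q \<le> edge_length f / 2"
  shows "bump f \<psi> \<in> short_maps"
  unfolding short_maps_def
proof (intro CollectI allI conjI)
  fix e p u
  have h: "\<bar>height (endpoint u e) - height (Mid e p)\<bar> = edge_length e / 2"
    by (cases u) (auto simp: height_endpoint)
  from branch_endpoint[of f u e p]
  show "\<bar>bump f \<psi> (endpoint u e) - bump f \<psi> (Mid e p)\<bar> \<le> edge_length e / 2"
  proof (elim disjE conjE)
    assume "branch f (endpoint u e) = branch f (Mid e p)"
    moreover have "\<bar>max 0 (c - \<bar>a - m\<bar>) - max 0 (c - \<bar>b - m\<bar>)\<bar> \<le> \<bar>a - b\<bar>" for a b c m :: real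
      by (auto simp: max_def)
    ultimately show ?thesis
      unfolding h[symmetric] by (cases "branch f (Mid e p)") (auto simp: bump_def)
  next
    assume *: "endpoint u e = endpoint u f" "branch f (endpoint u e) = None"
    have "\<bar>height (endpoint u f) - mid_height f\<bar> = edge_length f / 2"
      by (cases u) (auto simp: height_endpoint)
    then have "edge_length f / 2 - \<bar>mid_height e - mid_height f\<bar> \<le> edge_length e / 2"
      using h unfolding *(1) height.simps by linarith
    moreover have "0 \<le> bump f \<psi> (Mid e p)" by (simp add: bump_def split: option.split)
    moreover have "bump f \<psi> (Mid e p) \<le> max 0 (edge_length f / 2 - \<bar>mid_height e - mid_height f\<bar>)"
    proof (cases "branch f (Mid e p)")
      case (Some q)
      then show ?thesis using le[of q] by (auto simp: bump_def intro!: max.mono)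
    qed (simp add: bump_def)
    moreover have "bump f \<psi> (endpoint u e) = 0" using * by (simp add: bump_def)
    ultimately show ?thesis using edge_length_pos[of e] by linarith
  qed
next
  fix e p q
  show "\<bar>bump f \<psi> (Mid e p) - bump f \<psi> (Mid e q)\<bar> \<le> edge_length e * \<bar>real_of_rat p - real_of_rat q\<bar>"
  proof (cases "e = f")
    case True
    then show ?thesis using lip[of p q] by (auto simp: bump_def max_def)
  next
    case False
    then have "branch f (Mid e p) = branch f (Mid e q)"
      by (cases e) auto
    then show ?thesis by (simp add: bump_def split: option.split)
  qed
qed

lemma hat_short:
  "bump e (\<lambda>q. edge_length e / 2 - edge_length e * \<bar>real_of_rat q - real_of_rat p\<bar>) \<in> short_maps"
    (is "bump e ?\<psi> \<in> _")
proof (rule bump_short)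
  fix q q'
  have "?\<psi> q - ?\<psi> q' = edge_length e * (\<bar>real_of_rat q' - real_of_rat p\<bar> - \<bar>real_of_rat q - real_of_rat p\<bar>)"
    by (simp add: algebra_simps)
  then show "\<bar>?\<psi> q - ?\<psi> q'\<bar> \<le> edge_length e * \<bar>real_of_rat q - real_of_rat q'\<bar>"
    by (auto simp: abs_mult intro!: mult_left_mono)
qed simp

text \<open>The bump at \<open>e\<close> that peaks at the parameter \<open>p\<close> attains its maximum only in \<open>Mid e p\<close>: vertices
  inside the halves of \<open>e\<close> are at a different height, by \<open>mid_height_gap\<close>.\<close>

lemma vdist_Mid_pos:
  assumes "x \<noteq> Mid e p"
  shows "0 < vdist (Mid e p) x"
proof -
  define \<psi> where "\<psi> q = edge_length e / 2 - edge_length e * \<bar>real_of_rat q - real_of_rat p\<bar>" for q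
  have \<psi>_le: "\<psi> q \<le> edge_length e / 2" for q by (simp add: \<psi>_def)
  have g: "bump e \<psi> \<in> short_maps" unfolding \<psi>_def by (rule hat_short)
  have "bump e \<psi> x < edge_length e / 2"
  proof (cases "branch e x")
    case (Some q)
    obtain e' p' where x: "x = Mid e' p'" using Some by (cases x) auto
    have "\<psi> q - \<bar>height x - mid_height e\<bar> < edge_length e / 2"
      using Some[unfolded x branch_iff]
    proof (elim disjE exE conjE)
      assume "e' = e" "p' = q"
      then have "0 < \<bar>real_of_rat q - real_of_rat p\<bar>" using assms x by auto
      then have "\<psi> q < edge_length e / 2" by (simp add: \<psi>_def)
      then show ?thesis by linarith
    next
      fix w u assume "e' = w @ (u, q) # e"
      then have "edge_length e' / 2 \<le> \<bar>mid_height e' - mid_height e\<bar>"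
        by (intro mid_height_gap[of u q]) (simp add: suffix_def)
      then show ?thesis using \<psi>_le[of q] edge_length_pos[of e'] unfolding x height.simps by linarith
    qed
    moreover have "bump e \<psi> x = max 0 (\<psi> q - \<bar>height x - mid_height e\<bar>)"
      using Some by (simp add: bump_def)
    ultimately show ?thesis using edge_length_pos[of e] by linarith
  qed (simp add: bump_def)
  moreover have "bump e \<psi> (Mid e p) = edge_length e / 2"
    by (simp add: bump_def \<psi>_def less_imp_le)
  ultimately show ?thesis using vdist_upper[OF g, of "Mid e p" x] by linarith
qed

lemma height_short: "height \<in> short_maps"
  unfolding short_maps_def
proof (intro CollectI allI conjI)
  fix e p u
  show "\<bar>height (endpoint u e) - height (Mid e p)\<bar> \<le> edge_length e / 2"
    by (cases u) (auto simp: height_endpoint)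
qed (simp add: less_imp_le)

lemma vdist_commute: "vdist x y = vdist y x"
  by (simp add: vdist_def abs_minus_commute)

interpretation vertex: Metric_space UNIV vdist
proof
  fix x y z :: vertex
  show "0 \<le> vdist x y" using vdist_upper[OF zero_short, of x y] by simp
  show "vdist x y = vdist y x" by (rule vdist_commute)
  show "vdist x y = 0 \<longleftrightarrow> x = y"
  proof
    assume 0: "vdist x y = 0"
    show "x = y"
    proof (rule ccontr)
      assume ne: "x \<noteq> y"
      consider e p where "x = Mid e p" | e p where "y = Mid e p" | u v where "x = Apex u" "y = Apex v"
        by (cases x; cases y) auto
      then show False
      proof cases
        case 1
        then show False using vdist_Mid_pos[of y e p] ne 0 by simp
      next
        case 2
        then show False using vdist_Mid_pos[of x e p] ne 0 by (simp add: vdist_commute)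
      next
        case 3
        then show False using vdist_upper[OF height_short, of x y] ne 0 by (cases u; cases v) auto
      qed
    qed
  next
    assume "x = y"
    then show "vdist x y = 0"
      using vdist_least[of x y 0] vdist_upper[OF zero_short, of x y] by simp
  qed
  show "vdist x z \<le> vdist x y + vdist y z"
  proof (rule vdist_least)
    fix g assume "g \<in> short_maps"
    from vdist_upper[OF this, of x y] vdist_upper[OF this, of y z]
    show "\<bar>g x - g z\<bar> \<le> vdist x y + vdist y z" by linarith
  qed
qed

definition code :: "vertex \<Rightarrow> nat \<Rightarrow> real" where
  "code x = (\<lambda>_. real (to_nat x))"

lemma inj_code: "inj code"
  by (auto simp: inj_on_def code_def fun_eq_iff)

definition edge_space :: "(nat \<Rightarrow> real) metric" where
  "edge_space = metric (range code, \<lambda>a b. vdist (inv code a) (inv code b))"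

lemma Metric_space_edge_space: "Metric_space (range code) (\<lambda>a b. vdist (inv code a) (inv code b))"
proof
  fix a b c
  show "0 \<le> vdist (inv code a) (inv code b)" by simp
  show "vdist (inv code a) (inv code b) = vdist (inv code b) (inv code a)" by (rule vdist_commute)
  show "vdist (inv code a) (inv code c) \<le> vdist (inv code a) (inv code b) + vdist (inv code b) (inv code c)"
    by (rule vertex.triangle) auto
  assume "a \<in> range code" "b \<in> range code"
  then show "vdist (inv code a) (inv code b) = 0 \<longleftrightarrow> a = b"
    by (auto simp: inj_code)
qed

lemma mspace_edge_space [simp]: "mspace edge_space = range code"
  unfolding edge_space_def by (rule Metric_space.mspace_metric[OF Metric_space_edge_space])

lemma mdist_edge_space [simp]: "mdist edge_space (code x) (code y) = vdist x y"
  unfolding edge_space_def Metric_space.mdist_metric[OF Metric_space_edge_space]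
  by (simp add: inj_code)

section \<open>The substitution space has no Lipschitz light map to Euclidean space\<close>

text \<open>Uniform convexity of the Euclidean norm: if \<open>x\<close> is within \<open>\<surd>t\<close> of both \<open>a\<close> and \<open>b\<close>, whose distance is almost
  \<open>2 * \<surd>t\<close>, then the parallelogram law bounds \<open>a + b - 2 * x\<close>, so any two such points are close.\<close>

lemma metric_midpoints_cluster:
  fixes a b x y :: "nat \<Rightarrow> real"
  assumes ax: "(\<Sum>i<n. (a i - x i)\<^sup>2) \<le> t" and xb: "(\<Sum>i<n. (x i - b i)\<^sup>2) \<le> t"
    and ay: "(\<Sum>i<n. (a i - y i)\<^sup>2) \<le> t" and yb: "(\<Sum>i<n. (y i - b i)\<^sup>2) \<le> t"
    and ab: "4 * t * (1 - \<epsilon>) \<le> (\<Sum>i<n. (a i - b i)\<^sup>2)"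
  shows "(\<Sum>i<n. (x i - y i)\<^sup>2) \<le> 4 * \<epsilon> * t"
proof -
  have mid: "(\<Sum>i<n. (a i + b i - 2 * z i)\<^sup>2) \<le> 4 * \<epsilon> * t"
    if "(\<Sum>i<n. (a i - z i)\<^sup>2) \<le> t" "(\<Sum>i<n. (z i - b i)\<^sup>2) \<le> t" for z
  proof -
    have "(\<Sum>i<n. (a i + b i - 2 * z i)\<^sup>2)
        = (\<Sum>i<n. 2 * (a i - z i)\<^sup>2 + 2 * (z i - b i)\<^sup>2 - (a i - b i)\<^sup>2)"
      by (intro sum.cong) (auto simp: power2_eq_square algebra_simps)
    also have "\<dots> = 2 * (\<Sum>i<n. (a i - z i)\<^sup>2) + 2 * (\<Sum>i<n. (z i - b i)\<^sup>2) - (\<Sum>i<n. (a i - b i)\<^sup>2)"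
      by (simp add: sum.distrib sum_subtractf sum_distrib_left)
    also have "\<dots> \<le> 4 * \<epsilon> * t" using that ab by (simp add: algebra_simps)
    finally show ?thesis .
  qed
  have "(\<Sum>i<n. (x i - y i)\<^sup>2)
      \<le> (\<Sum>i<n. (a i + b i - 2 * x i)\<^sup>2 / 2 + (a i + b i - 2 * y i)\<^sup>2 / 2)"
  proof (rule sum_mono)
    fix i
    have "0 \<le> ((a i + b i - 2 * x i) + (a i + b i - 2 * y i))\<^sup>2" by simp
    then show "(x i - y i)\<^sup>2 \<le> (a i + b i - 2 * x i)\<^sup>2 / 2 + (a i + b i - 2 * y i)\<^sup>2 / 2"
      by (simp add: power2_eq_square field_simps)
  qed
  also have "\<dots> = (\<Sum>i<n. (a i + b i - 2 * x i)\<^sup>2) / 2 + (\<Sum>i<n. (a i + b i - 2 * y i)\<^sup>2) / 2"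
    by (simp add: sum.distrib sum_divide_distrib)
  also have "\<dots> \<le> 4 * \<epsilon> * t" using mid[OF ax xb] mid[OF ay yb] by simp
  finally show ?thesis .
qed

lemma vdist_endpoint_Mid: "vdist (endpoint u e) (Mid e p) \<le> edge_length e / 2"
  by (intro vdist_least short_endpoint_step)

lemma vdist_Mid_Mid: "vdist (Mid e p) (Mid e q) \<le> edge_length e * \<bar>real_of_rat p - real_of_rat q\<bar>"
  by (intro vdist_least short_path_step)

lemma vdist_Mid_0_1: "edge_length e / 2 \<le> vdist (Mid e 0) (Mid e 1)"
proof -
  let ?g = "bump e (\<lambda>q. edge_length e / 2 - edge_length e * \<bar>real_of_rat q - real_of_rat 0\<bar>)"
  have "?g (Mid e 0) = edge_length e / 2" "?g (Mid e 1) = 0"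
    by (auto simp: bump_def max_def intro: antisym)
  then show ?thesis using vdist_upper[OF hat_short, of e 0 "Mid e 0" "Mid e 1"] by simp
qed

text \<open>Near-maximality of the slope is what controls the midpoints: the two halves of \<open>e\<close> at a midpoint are
  themselves edges, hence have slope at most \<open>\<sigma>\<close>.\<close>

theorem no_Lipschitz_light_edge_space:
  "\<not> Lipschitz_light edge_space (Euclidean_metric n) F"
proof
  assume "Lipschitz_light edge_space (Euclidean_metric n) F"
  then obtain C where F: "F \<in> range code \<rightarrow> mspace (Euclidean_metric n)" and C0: "0 < C"
    and Lip': "\<forall>x\<in>range code. \<forall>y\<in>range code. mdist (Euclidean_metric n) (F x) (F y) \<le> C * mdist edge_space x y"
    and light: "\<forall>r>0. \<forall>W\<subseteq>mspace (Euclidean_metric n). mdiameter (Euclidean_metric n) W \<le> ennreal r \<longrightarrow>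
           (\<forall>K\<in>r_components (submetric edge_space (F -` W)) r. mdiameter edge_space K \<le> ennreal (C * r))"
    unfolding Lipschitz_light_def mspace_edge_space by blast
  define N where "N x y = L2_set (\<lambda>i. F (code x) i - F (code y) i) {..<n}" for x y
  have N0: "0 \<le> N x y" for x y by (simp add: N_def)
  have Nsq: "(N x y)\<^sup>2 = (\<Sum>i<n. (F (code x) i - F (code y) i)\<^sup>2)" for x y
    by (simp add: N_def L2_set_def sum_nonneg)
  have Ncomm: "N x y = N y x" for x y by (simp add: N_def L2_set_def power2_commute)
  have Lip: "N x y \<le> C * vdist x y" for x y
    using Lip' unfolding N_def mdist_edge_space[symmetric] by auto
  define slope where "slope e = N (endpoint True e) (endpoint False e) / edge_length e" for e
  define \<sigma> where "\<sigma> = (SUP e. slope e)"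
  have slope_le: "slope e \<le> C" for e
  proof -
    have "vdist (endpoint True e) (endpoint False e) \<le> edge_length e"
      using vertex.triangle[of "endpoint True e" "Mid e 0" "endpoint False e"]
        vdist_endpoint_Mid[of True e 0] vdist_endpoint_Mid[of False e 0]
      by (simp add: vdist_commute)
    then have "C * vdist (endpoint True e) (endpoint False e) \<le> C * edge_length e"
      using C0 by simp
    with Lip have "N (endpoint True e) (endpoint False e) \<le> C * edge_length e" by (rule order_trans)
    then show ?thesis by (simp add: slope_def divide_simps)
  qed
  then have bdd: "bdd_above (range slope)" by (intro bdd_aboveI2)
  have slope_\<sigma>: "slope e \<le> \<sigma>" for e unfolding \<sigma>_def using bdd by (intro cSUP_upper) auto
  have slope0: "0 \<le> slope e" for e using N0 by (simp add: slope_def)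
  have \<sigma>0: "0 \<le> \<sigma>" using slope0 slope_\<sigma> by (rule order_trans)
  have half: "N (endpoint u e) (Mid e q) \<le> \<sigma> * (edge_length e / 2)" for u e q
    using slope_\<sigma>[of "(u, q) # e"]
    by (cases u) (auto simp: slope_def divide_simps Ncomm mult.commute)
  obtain m :: nat where m: "2 * C < real m" using reals_Archimedean2 by blast
  then have m0: "0 < real m" using C0 by linarith
  \<comment> \<open>The path of midpoints of an edge of length \<open>l\<close> will be divided into \<open>m\<close> steps of length \<open>l / m\<close>, and
    \<open>\<epsilon>\<close> is such that its image has diameter at most \<open>l / m\<close> as well; its own diameter is at least \<open>l / 2\<close>, which exceeds \<open>C * l / m\<close>.\<close>
  define \<epsilon> where "\<epsilon> = 1 / ((real m)\<^sup>2 * (\<sigma>\<^sup>2 + 1))"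
  have s1: "0 < \<sigma>\<^sup>2 + 1" by (simp add: add_nonneg_pos)
  have \<epsilon>0: "0 < \<epsilon>" using m0 s1 by (simp add: \<epsilon>_def)
  have \<epsilon>1: "\<epsilon> \<le> 1"
  proof -
    have "1 \<le> real m" using m0 by simp
    then have "1 * 1 \<le> (real m)\<^sup>2 * (\<sigma>\<^sup>2 + 1)" by (intro mult_mono) auto
    then show ?thesis by (simp add: \<epsilon>_def)
  qed
  obtain e where e: "\<sigma> * (1 - \<epsilon> / 2) \<le> slope e"
  proof (cases "\<sigma> = 0")
    case True
    then show ?thesis using that[of "[]"] slope0 by simp
  next
    case False
    then have "\<sigma> * (1 - \<epsilon> / 2) < \<sigma>" using \<sigma>0 \<epsilon>0 by (simp add: algebra_simps)
    then obtain e where "\<sigma> * (1 - \<epsilon> / 2) < slope e"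
      unfolding \<sigma>_def using less_cSUP_iff[OF _ bdd] by auto
    then show ?thesis by (intro that[of e] less_imp_le)
  qed
  define \<tau> where "\<tau> = \<sigma> * (edge_length e / 2)"
  define r where "r = edge_length e / real m"
  have r0: "0 < r" using m0 by (simp add: r_def)
  have \<tau>0: "0 \<le> \<tau>" using \<sigma>0 by (simp add: \<tau>_def)
  have spread: "N (Mid e p) (Mid e q) \<le> r" for p q
  proof -
    have le: "N (endpoint u e) (Mid e q) \<le> \<tau>" for u q using half unfolding \<tau>_def .
    have sq: "(N (endpoint u e) (Mid e q))\<^sup>2 \<le> \<tau>\<^sup>2" for u q
      using le N0 by (intro power_mono)
    have "\<sigma> * (1 - \<epsilon> / 2) * edge_length e \<le> N (endpoint True e) (endpoint False e)"
      using e by (simp add: slope_def divide_simps)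
    then have "2 * \<tau> * (1 - \<epsilon> / 2) \<le> N (endpoint True e) (endpoint False e)"
      by (simp add: \<tau>_def algebra_simps)
    then have "(2 * \<tau> * (1 - \<epsilon> / 2))\<^sup>2 \<le> (N (endpoint True e) (endpoint False e))\<^sup>2"
      using \<tau>0 \<epsilon>1 by (intro power_mono) auto
    moreover have "4 * \<tau>\<^sup>2 * (1 - \<epsilon>) \<le> (2 * \<tau> * (1 - \<epsilon> / 2))\<^sup>2"
    proof -
      have "(2 * \<tau> * (1 - \<epsilon> / 2))\<^sup>2 = 4 * \<tau>\<^sup>2 * (1 - \<epsilon>) + (\<tau> * \<epsilon>)\<^sup>2"
        by (simp add: power2_eq_square algebra_simps)
      then show ?thesis by simp
    qed
    ultimately have "4 * \<tau>\<^sup>2 * (1 - \<epsilon>) \<le> (N (endpoint True e) (endpoint False e))\<^sup>2" by linarith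
    then have "(N (Mid e p) (Mid e q))\<^sup>2 \<le> 4 * \<epsilon> * \<tau>\<^sup>2"
      using sq[of True] sq[of False] unfolding Ncomm[of "endpoint False e"] Nsq
      by (intro metric_midpoints_cluster)
    also have "\<dots> = (edge_length e / real m)\<^sup>2 * (\<sigma>\<^sup>2 / (\<sigma>\<^sup>2 + 1))"
      by (simp add: \<tau>_def \<epsilon>_def power_mult_distrib power_divide)
    also have "\<dots> \<le> (edge_length e / real m)\<^sup>2 * 1"
      using s1 by (intro mult_left_mono) (auto simp: divide_simps)
    finally have "(N (Mid e p) (Mid e q))\<^sup>2 \<le> r\<^sup>2" by (simp add: r_def)
    then show ?thesis by (rule power2_le_imp_le) (simp add: r0 less_imp_le)
  qed
  define W where "W = range (\<lambda>q. F (code (Mid e q)))"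
  have "W \<subseteq> mspace (Euclidean_metric n)" 
    unfolding W_def by (intro image_subsetI funcset_mem[OF F] rangeI)
  moreover have "mdiameter (Euclidean_metric n) W \<le> ennreal r"
    unfolding mdiameter_le_iff[OF less_imp_le[OF r0]] W_def using spread by (auto simp: N_def)
  ultimately have comps: "mdiameter edge_space K \<le> ennreal (C * r)"
    if "K \<in> r_components (submetric edge_space (F -` W)) r" for K
    using light r0 that by blast
  let ?S = "submetric edge_space (F -` W)"
  have inS: "code (Mid e q) \<in> mspace ?S" for q by (auto simp: W_def)
  define xs where "xs = map (\<lambda>i. code (Mid e (of_nat i / of_nat m))) [0..<Suc m]"
  have "r_path ?S r xs"
    unfolding r_path_def
  proof
    show "set xs \<subseteq> mspace ?S" using inS unfolding xs_def by auto
    show "successively (\<lambda>x y. mdist ?S x y \<le> r) xs"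
      unfolding successively_conv_nth
    proof (intro allI impI)
      fix i assume i: "Suc i < length xs"
      have "vdist (Mid e (of_nat i / of_nat m)) (Mid e (of_nat (Suc i) / of_nat m))
          \<le> edge_length e * \<bar>real_of_rat (of_nat i / of_nat m) - real_of_rat (of_nat (Suc i) / of_nat m)\<bar>"
        by (rule vdist_Mid_Mid)
      also have "\<bar>real_of_rat (of_nat i / of_nat m) - real_of_rat (of_nat (Suc i) / of_nat m)\<bar> = 1 / real m"
        using m0 by (simp add: of_rat_divide of_rat_add diff_divide_distrib[symmetric])
      finally have "vdist (Mid e (of_nat i / of_nat m)) (Mid e (of_nat (Suc i) / of_nat m)) \<le> r"
        by (simp add: r_def)
      moreover have "xs ! i = code (Mid e (of_nat i / of_nat m))"
        "xs ! Suc i = code (Mid e (of_nat (Suc i) / of_nat m))"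
        using i unfolding xs_def by (simp_all del: upt_Suc of_nat_Suc)
      ultimately show "mdist ?S (xs ! i) (xs ! Suc i) \<le> r" by simp
    qed
  qed
  moreover have "code (Mid e 0) \<in> set xs"
    unfolding xs_def by (auto simp del: upt_Suc intro!: image_eqI[of _ _ 0])
  moreover have "code (Mid e 1) \<in> set xs"
    unfolding xs_def using m0 by (auto simp del: upt_Suc intro!: image_eqI[of _ _ m])
  ultimately have "same_r_component ?S r (code (Mid e 0)) (code (Mid e 1))"
    "same_r_component ?S r (code (Mid e 0)) (code (Mid e 0))"
    unfolding same_r_component_def by blast+
  then have ends: "code (Mid e 0) \<in> {(x, y). same_r_component ?S r x y} `` {code (Mid e 0)}"
    "code (Mid e 1) \<in> {(x, y). same_r_component ?S r x y} `` {code (Mid e 0)}" by auto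
  have "mdiameter edge_space ({(x, y). same_r_component ?S r x y} `` {code (Mid e 0)}) \<le> ennreal (C * r)"
    by (rule comps) (auto simp only: r_components_def intro!: quotientI inS)
  moreover have "0 \<le> C * r" using C0 r0 by simp
  ultimately have "mdist edge_space (code (Mid e 0)) (code (Mid e 1)) \<le> C * r"
    using ends by (simp only: mdiameter_le_iff)
  moreover have "C * r < edge_length e / 2"
  proof -
    have "C * r = edge_length e * (C / real m)" by (simp add: r_def)
    also have "\<dots> < edge_length e * (1 / 2)"
      using m m0 by (intro mult_strict_left_mono) (auto simp: divide_simps)
    finally show ?thesis by simp
  qed
  ultimately show False using vdist_Mid_0_1[of e] by simp
qed

section \<open>The substitution space has finite Nagata dimension\<close>

text \<open>The cover at scale \<open>s = (1/2)\<^sup>k\<close>. Vertices whose height, counted from an end of the root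
  edge, is within \<open>s / 4\<close> of a multiple of \<open>s\<close> are near an apex or near a midpoint of an edge longer than
  \<open>s\<close>. The midpoints of such an edge form a long path; this path is cut into intervals of length \<open>s\<close>, distributed over two families by the parity
  of \<open>i\<close> (\<open>path_cell\<close>). The other heights belong to the middle parts of edges of length \<open>s\<close>
  (\<open>middle_cell\<close>). The neighbourhoods of the two apexes form two further families of a single set each.\<close>

definition path_cell :: "nat \<Rightarrow> edge \<Rightarrow> int \<Rightarrow> vertex set" where
  "path_cell k e i =
     {x. \<exists>q. branch e x = Some q \<and> \<bar>height x - mid_height e\<bar> \<le> (1/2)^k / 4 \<and>
             \<lfloor>real_of_rat q * 2^k * edge_length e\<rfloor> = i}"

definition middle_cell :: "edge \<Rightarrow> vertex set" where
  "middle_cell e = {x. branch e x \<noteq> None \<and> \<bar>height x - mid_height e\<bar> \<le> edge_length e / 4}"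

definition apex_cell :: "nat \<Rightarrow> bool \<Rightarrow> vertex set" where
  "apex_cell k u = {x. \<bar>height x - height (Apex u)\<bar> \<le> (1/2)^k / 4}"

definition cells :: "nat \<Rightarrow> nat \<Rightarrow> vertex set set" where
  "cells k c =
     (if c < 2 then {path_cell k e i | e i. length e < k \<and> i mod 2 = int c}
      else if c = 2 then {middle_cell e | e. length e = k}
      else {apex_cell k (c = 3)})"

lemma path_cell_diameter:
  assumes "x \<in> path_cell k e i" "y \<in> path_cell k e i"
  shows "vdist x y \<le> 3/2 * (1/2)^k"
proof (rule vdist_least)
  fix g assume g: "g \<in> short_maps"
  obtain p where p: "branch e x = Some p" "\<bar>height x - mid_height e\<bar> \<le> (1/2)^k / 4"
    "\<lfloor>real_of_rat p * 2^k * edge_length e\<rfloor> = i" using assms(1) by (auto simp: path_cell_def)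
  obtain q where q: "branch e y = Some q" "\<bar>height y - mid_height e\<bar> \<le> (1/2)^k / 4"
    "\<lfloor>real_of_rat q * 2^k * edge_length e\<rfloor> = i" using assms(2) by (auto simp: path_cell_def)
  have "\<bar>real_of_rat p * 2^k * edge_length e - real_of_rat q * 2^k * edge_length e\<bar> \<le> 1"
    using p(3) q(3) by linarith
  also have "real_of_rat p * 2^k * edge_length e - real_of_rat q * 2^k * edge_length e
      = 2^k * (edge_length e * (real_of_rat p - real_of_rat q))" by (simp add: algebra_simps)
  finally have "2^k * (edge_length e * \<bar>real_of_rat p - real_of_rat q\<bar>) \<le> 1"
    by (simp add: abs_mult)
  then have "edge_length e * \<bar>real_of_rat p - real_of_rat q\<bar> \<le> (1/2)^k"
    by (simp add: field_simps)
  then show "\<bar>g x - g y\<bar> \<le> 3/2 * (1/2)^k"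
    using short_branch[OF g p(1)] short_branch[OF g q(1)] short_path_step[OF g, of e p q] p(2) q(2)
    by linarith
qed

lemma middle_cell_diameter:
  assumes "x \<in> middle_cell e" "y \<in> middle_cell e"
  shows "vdist x y \<le> 3/2 * edge_length e"
proof (rule vdist_least)
  fix g assume g: "g \<in> short_maps"
  have "\<bar>g z - g (endpoint True e)\<bar> \<le> 3/4 * edge_length e" if "z \<in> middle_cell e" for z
  proof -
    have "\<bar>g z - g (endpoint True e)\<bar> \<le> edge_length e / 2 + (mid_height e - height z)"
      using short_endpoint[OF g, of e z True] that by (simp add: middle_cell_def height_endpoint)
    moreover have "\<bar>height z - mid_height e\<bar> \<le> edge_length e / 4"
      using that by (simp add: middle_cell_def)
    ultimately show ?thesis by linarith
  qed
  from this[OF assms(1)] this[OF assms(2)] show "\<bar>g x - g y\<bar> \<le> 3/2 * edge_length e" by linarith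
qed

lemma apex_cell_diameter:
  assumes "x \<in> apex_cell k u" "y \<in> apex_cell k u"
  shows "vdist x y \<le> 3/2 * (1/2)^k"
proof (rule vdist_least)
  fix g assume g: "g \<in> short_maps"
  have "\<bar>g z - g (Apex u)\<bar> \<le> (1/2)^k / 4" if "z \<in> apex_cell k u" for z
    using short_Apex[OF g, of z u] that by (cases u) (auto simp: apex_cell_def)
  from this[OF assms(1)] this[OF assms(2)] show "\<bar>g x - g y\<bar> \<le> 3/2 * (1/2)^k"
    using zero_less_power[of "1/2::real" k] by linarith
qed

text \<open>Two edges around a common vertex are nested, so the inner one lies strictly inside a half of the outer
  one and its centre stays away from the ends of that half.\<close>

lemma mid_height_separated:
  assumes "branch e x \<noteq> None" "branch f x \<noteq> None" "e \<noteq> f" "length e < k" "length f < k"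
  shows "(1/2)^k \<le> \<bar>mid_height e - mid_height f\<bar>"
proof -
  have gap: "(1/2)^k \<le> \<bar>mid_height b - mid_height a\<bar>"
    if ab: "suffix a b" "a \<noteq> b" "length b < k" for a b
  proof -
    obtain w where w: "b = w @ a" using ab(1) by (auto simp: suffix_def)
    then have "w \<noteq> []" using ab(2) by auto
    then obtain w' v q where "w = w' @ [(v, q)]" by (metis rev_exhaust surj_pair)
    then have "suffix ((v, q) # a) b" using w by (simp add: suffix_def)
    then have "edge_length b / 2 \<le> \<bar>mid_height b - mid_height a\<bar>" by (rule mid_height_gap)
    moreover have "(1/2)^k \<le> (1/2::real)^Suc (length b)"
      using ab(3) by (intro power_decreasing) auto
    ultimately show ?thesis by (simp add: edge_length_def)
  qed
  obtain d p where "x = Mid d p" using assms(1) by (cases x) auto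
  then have "suffix e d" "suffix f d" using assms(1,2) branch_suffix by auto
  then have "suffix e f \<or> suffix f e" by (rule suffix_same_cases)
  then show ?thesis using gap[of e f] gap[of f e] assms by (auto simp: abs_minus_commute)
qed

text \<open>The bump that separates the cell with index \<open>i\<close> from the others uses, as a function on the midpoints of
  \<open>e\<close>, the value \<open>s / 2\<close> minus the distance to the \<open>i\<close>-th interval. Cells of the same edge are at least one
  interval apart, by parity, and cells of other edges are too far away in height whenever they meet
  the interior of \<open>e\<close>.\<close>

lemma path_cells_separated:
  assumes x: "x \<in> path_cell k e i" and y: "y \<in> path_cell k f j"
    and len: "length e < k" "length f < k" and par: "i mod 2 = j mod 2" and ne: "(e, i) \<noteq> (f, j)"
  shows "(1/2)^k / 4 \<le> vdist x y"
proof -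
  define s :: real where "s = (1/2)^k"
  have s0: "0 < s" and s2: "s * 2^k = 1" by (simp_all add: s_def field_simps)
  define z where "z q = real_of_rat q * 2^k * edge_length e" for q
  define \<psi> where "\<psi> q = s * (1/2 - max 0 (max (real_of_int i - z q) (z q - (real_of_int i + 1))))" for q
  have g: "bump e \<psi> \<in> short_maps"
  proof (rule bump_short)
    fix p q
    have "\<bar>max 0 (max (c - a) (a - d)) - max 0 (max (c - b) (b - d))\<bar> \<le> \<bar>b - a\<bar>" for a b c d :: real
      by (auto simp: max_def)
    then have "\<bar>\<psi> p - \<psi> q\<bar> \<le> s * \<bar>z p - z q\<bar>"
      unfolding \<psi>_def right_diff_distrib[symmetric] abs_mult using s0
      by (simp add: abs_minus_commute)
    also have "z p - z q = 2^k * (edge_length e * (real_of_rat p - real_of_rat q))"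
      by (simp add: z_def algebra_simps)
    also have "s * \<bar>\<dots>\<bar> = (s * 2^k) * (edge_length e * \<bar>real_of_rat p - real_of_rat q\<bar>)"
      by (simp add: abs_mult)
    finally show "\<bar>\<psi> p - \<psi> q\<bar> \<le> edge_length e * \<bar>real_of_rat p - real_of_rat q\<bar>"
      unfolding s2 by simp
  next
    fix q
    have "\<psi> q \<le> s * (1/2)" unfolding \<psi>_def using s0 by (intro mult_left_mono) auto
    also have "s \<le> edge_length e"
      unfolding s_def edge_length_def using len by (intro power_decreasing) auto
    finally show "\<psi> q \<le> edge_length e / 2" by simp
  qed
  have "s / 4 \<le> bump e \<psi> x"
  proof -
    obtain p where p: "branch e x = Some p" "\<bar>height x - mid_height e\<bar> \<le> s / 4" "\<lfloor>z p\<rfloor> = i"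
      using x by (auto simp: path_cell_def s_def z_def)
    have "\<psi> p = s / 2" using p(3) unfolding \<psi>_def by (simp add: max_def; linarith)
    then have "s / 4 \<le> \<psi> p - \<bar>height x - mid_height e\<bar>" using p(2) by linarith
    moreover have "bump e \<psi> x = max 0 (\<psi> p - \<bar>height x - mid_height e\<bar>)"
      using p(1) by (simp add: bump_def)
    ultimately show ?thesis by linarith
  qed
  moreover have "bump e \<psi> y = 0"
  proof (cases "branch e y")
    case (Some q)
    obtain q' where q': "branch f y = Some q'" "\<bar>height y - mid_height f\<bar> \<le> s / 4"
      "\<lfloor>real_of_rat q' * 2^k * edge_length f\<rfloor> = j"
      using y by (auto simp: path_cell_def s_def)
    have "\<psi> q - \<bar>height y - mid_height e\<bar> \<le> 0"
    proof (cases "e = f")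
      case True
      then have zq: "\<lfloor>z q\<rfloor> = j" using q' Some by (simp add: z_def)
      have "j \<le> i - 2 \<or> i + 2 \<le> j" 
      proof -
        have "i \<noteq> j" using ne True by simp
        then show ?thesis using par by presburger
      qed
      then have "1 \<le> max 0 (max (real_of_int i - z q) (z q - (real_of_int i + 1)))"
        using zq by linarith
      then have "1/2 - max 0 (max (real_of_int i - z q) (z q - (real_of_int i + 1))) \<le> 0"
        by linarith
      then have "\<psi> q \<le> s * 0" unfolding \<psi>_def using s0 by (intro mult_left_mono) simp_all
      then show ?thesis by simp
    next
      case False
      then have "s \<le> \<bar>mid_height e - mid_height f\<bar>"
        unfolding s_def using Some q' len by (intro mid_height_separated[of _ y]) auto
      moreover have "\<psi> q \<le> s * (1/2)" unfolding \<psi>_def using s0 by (intro mult_left_mono) auto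
      ultimately show ?thesis using q'(2) s0 by linarith
    qed
    then show ?thesis using Some by (simp add: bump_def)
  qed (simp add: bump_def)
  ultimately show ?thesis using vdist_upper[OF g, of x y] unfolding s_def by linarith
qed

lemma middle_cells_separated:
  assumes x: "x \<in> middle_cell e" and y: "y \<in> middle_cell f" and len: "length e = length f" and ne: "e \<noteq> f"
  shows "edge_length e / 4 \<le> vdist x y"
proof -
  have g: "bump e (\<lambda>_. edge_length e / 2) \<in> short_maps" by (rule bump_short) auto
  have "edge_length e / 4 \<le> bump e (\<lambda>_. edge_length e / 2) x"
  proof -
    obtain q where "branch e x = Some q" "\<bar>height x - mid_height e\<bar> \<le> edge_length e / 4"
      using x by (auto simp: middle_cell_def)
    moreover from this have
      "bump e (\<lambda>_. edge_length e / 2) x = max 0 (edge_length e / 2 - \<bar>height x - mid_height e\<bar>)"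
      by (simp add: bump_def)
    ultimately show ?thesis by linarith
  qed
  moreover have "branch e y = None"
  proof (rule ccontr)
    assume "branch e y \<noteq> None"
    moreover have "branch f y \<noteq> None" using y by (simp add: middle_cell_def)
    moreover obtain d p where "y = Mid d p" using \<open>branch f y \<noteq> None\<close> by (cases y) auto
    ultimately have "suffix e d" "suffix f d" using branch_suffix by auto
    then have "suffix e f \<or> suffix f e" by (rule suffix_same_cases)
    then show False using len ne by (auto simp: suffix_def)
  qed
  then have "bump e (\<lambda>_. edge_length e / 2) y = 0" by (simp add: bump_def)
  ultimately show ?thesis using vdist_upper[OF g, of x y] by linarith
qed

lemma cells_diameter:
  assumes "A \<in> cells k c" "x \<in> A" "y \<in> A"
  shows "vdist x y \<le> 3/2 * (1/2)^k"
proof -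
  consider "c < 2" | "c = 2" | "2 < c" by linarith
  then show ?thesis
  proof cases
    case 1
    then obtain e i where "A = path_cell k e i" using assms(1) by (auto simp: cells_def)
    then show ?thesis using path_cell_diameter assms(2,3) by simp
  next
    case 2
    then obtain e where "A = middle_cell e" "length e = k" using assms(1) by (auto simp: cells_def)
    then show ?thesis using middle_cell_diameter[of x e y] assms(2,3) by (simp add: edge_length_def)
  next
    case 3
    then have "A = apex_cell k (c = 3)" using assms(1) by (simp add: cells_def)
    then show ?thesis using apex_cell_diameter assms(2,3) by simp
  qed
qed

lemma cells_separated:
  assumes "A \<in> cells k c" "B \<in> cells k c" "x \<in> A" "y \<in> B" "vdist x y < (1/2)^k / 4"
  shows "A = B"
proof -
  consider "c < 2" | "c = 2" | "2 < c" by linarith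
  then show ?thesis
  proof cases
    case 1
    then obtain e i f j where AB: "A = path_cell k e i" "B = path_cell k f j" "length e < k" "length f < k"
      "i mod 2 = int c" "j mod 2 = int c"
      using assms(1,2) by (auto simp: cells_def)
    have "(e, i) = (f, j)"
    proof (rule ccontr)
      assume "(e, i) \<noteq> (f, j)"
      then have "(1/2)^k / 4 \<le> vdist x y"
        using AB assms(3,4) by (intro path_cells_separated[of x k e i y f j]) auto
      then show False using assms(5) by simp
    qed
    then show ?thesis using AB by simp
  next
    case 2
    then obtain e f where AB: "A = middle_cell e" "B = middle_cell f" "length e = k" "length f = k"
      using assms(1,2) by (auto simp: cells_def)
    have "e = f"
    proof (rule ccontr)
      assume "e \<noteq> f"
      then have "edge_length e / 4 \<le> vdist x y"
        using AB assms(3,4) by (intro middle_cells_separated[of x e y f]) auto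
      then show False using assms(5) AB by (simp add: edge_length_def)
    qed
    then show ?thesis using AB by simp
  next
    case 3
    then show ?thesis using assms(1,2) by (simp add: cells_def)
  qed
qed

lemma apex_cell_in_cells: "\<exists>c<5. apex_cell k u \<in> cells k c"
  by (intro exI[of _ "if u then 3 else 4"]) (simp add: cells_def)

lemma path_cell_in_cells: "length e < k \<Longrightarrow> \<exists>c<5. path_cell k e i \<in> cells k c"
  by (intro exI[of _ "nat (i mod 2)"]) (auto simp: cells_def nat_less_iff)

text \<open>A vertex inside an edge \<open>f\<close> of level \<open>k\<close> is either in the middle part of \<open>f\<close> or within \<open>s / 4\<close> in height of an
  end of \<open>f\<close>; by \<open>endpoint_cases\<close> this end is an apex or a midpoint of an edge of smaller level, and in the
  latter case the vertex branches off there.\<close>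

lemma cells_cover: "\<exists>c<5. \<exists>A\<in>cells k c. x \<in> A"
proof -
  have path: ?thesis if "branch e x = Some q" "\<bar>height x - mid_height e\<bar> \<le> (1/2)^k / 4" "length e < k" for e q
  proof -
    have "x \<in> path_cell k e \<lfloor>real_of_rat q * 2^k * edge_length e\<rfloor>"
      using that by (simp add: path_cell_def)
    then show ?thesis using path_cell_in_cells[OF that(3)] by blast
  qed
  have apex: ?thesis if "\<bar>height x - height (Apex u)\<bar> \<le> (1/2)^k / 4" for u
  proof -
    have "x \<in> apex_cell k u" using that by (simp add: apex_cell_def)
    then show ?thesis using apex_cell_in_cells by blast
  qed
  show ?thesis
  proof (cases x)
    case (Apex u)
    then show ?thesis by (intro apex[of u]) simp
  next
    case (Mid e p)
    show ?thesis
    proof (cases "length e < k")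
      case True
      then show ?thesis using Mid by (intro path[of e p]) auto
    next
      case False
      define f where "f = drop (length e - k) e"
      have f: "length f = k" "suffix f e" using False by (auto simp: f_def suffix_drop)
      have len: "edge_length f = (1/2)^k" using f by (simp add: edge_length_def)
      have br: "branch f x \<noteq> None" unfolding Mid branch_suffix by (rule f)
      have h: "\<bar>height x - mid_height f\<bar> \<le> (1/2)^k / 2"
        using mid_height_within[OF f(2)] edge_length_nonneg(1)[of e] unfolding Mid height.simps len
        by linarith
      show ?thesis
      proof (cases "\<bar>height x - mid_height f\<bar> \<le> (1/2)^k / 4")
        case True
        then have "x \<in> middle_cell f" using br len by (simp add: middle_cell_def)
        moreover have "middle_cell f \<in> cells k 2" using f by (auto simp: cells_def)
        ultimately show ?thesis by (intro exI[of _ 2]) auto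
      next
        case far: False
        define u where "u = (mid_height f < height x)"
        have near: "\<bar>height x - height (endpoint u f)\<bar> \<le> (1/2)^k / 4"
        proof (cases "mid_height f < height x")
          case True
          then show ?thesis using far h by (simp add: u_def height_endpoint len)
        next
          case False
          then show ?thesis using far h by (simp add: u_def height_endpoint len)
        qed
        from endpoint_cases[of u f] show ?thesis
        proof (elim disjE exE conjE)
          assume "endpoint u f = Apex u"
          then show ?thesis using near by (intro apex[of u]) simp
        next
          fix w f' q assume *: "endpoint u f = Mid f' q" "f = w @ (\<not> u, q) # f'"
          obtain w' where "e = w' @ f" using f by (auto simp: suffix_def)
          then have "branch f' x = Some q" using * unfolding Mid branch_iff by auto
          moreover have "length f' < k" using f * by auto
          ultimately show ?thesis using near * by (intro path[of f' q]) auto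
        qed
      qed
    qed
  qed
qed

text \<open>Cells of scale \<open>(1/2)\<^sup>k\<close> are separated by a quarter of the scale. So \<open>k\<close> is taken largest with
  \<open>r < (1/2)\<^sup>k / 4\<close>, and the diameters are at most \<open>3/2 * (1/2)\<^sup>k \<le> 12 * r\<close>. If \<open>r \<ge> 1/4\<close>, a single set will do,
  since the space has diameter at most \<open>2\<close>.\<close>

lemma edge_space_separated_cover:
  assumes "0 < r"
  shows "\<exists>\<U>. separated_cover edge_space 5 r (12 * r) \<U>"
proof (cases "1/4 \<le> r")
  case True
  have "separated_cover edge_space 5 r (12 * r) (\<lambda>_. {range code})"
    unfolding separated_cover_def
  proof (intro conjI allI impI ballI)
    fix c A a b assume "A \<in> {range code}" "a \<in> A" "b \<in> A"
    then obtain x y where "a = code x" "b = code y" by blast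
    then have "mdist edge_space a b \<le> 2" using vdist_le_2 by simp
    then show "mdist edge_space a b \<le> 12 * r" using True by linarith
  qed (auto simp: lessThan_empty_iff)
  then show ?thesis by blast
next
  case False
  obtain k where k: "(1/2)^Suc k / 4 \<le> r" "r < (1/2)^k / 4"
  proof -
    obtain N where "(1/2)^N < 4 * r"
      using real_arch_pow_inv[of "4 * r" "1/2"] assms by auto
    then have ex: "\<exists>n. (1/2)^n / 4 \<le> r" by (intro exI[of _ N]) simp
    define n where "n = (LEAST n. (1/2)^n / 4 \<le> r)"
    have n: "(1/2)^n / 4 \<le> r" unfolding n_def using ex by (rule LeastI_ex)
    have "n \<noteq> 0" using n False by (intro notI) simp
    then obtain k where k: "n = Suc k" by (cases n) auto
    then have "\<not> (1/2)^k / 4 \<le> r" unfolding n_def by (intro not_less_Least) (simp add: n_def)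
    then show ?thesis using that n k by auto
  qed
  have "separated_cover edge_space 5 r (12 * r) (\<lambda>c. (`) code ` cells k c)"
    unfolding separated_cover_def
  proof (intro conjI allI impI ballI)
    show "mspace edge_space \<subseteq> (\<Union>c<5. \<Union>((`) code ` cells k c))"
    proof
      fix a assume "a \<in> mspace edge_space"
      then obtain x where "a = code x" by auto
      then show "a \<in> (\<Union>c<5. \<Union>((`) code ` cells k c))" using cells_cover[of k x] by blast
    qed
  next
    fix c A B assume "A \<in> (`) code ` cells k c" "B \<in> (`) code ` cells k c"
      and "\<exists>a\<in>A. \<exists>b\<in>B. mdist edge_space a b \<le> r"
    then obtain A' B' x y where AB: "A' \<in> cells k c" "B' \<in> cells k c" "A = code ` A'" "B = code ` B'"
      "x \<in> A'" "y \<in> B'" "mdist edge_space (code x) (code y) \<le> r" by blast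
    then have "vdist x y < (1/2)^k / 4" using k(2) by simp
    then have "A' = B'" using cells_separated AB by blast
    then show "A = B" using AB by simp
  next
    fix c A a b assume "A \<in> (`) code ` cells k c" "a \<in> A" "b \<in> A"
    then obtain A' x y where "A' \<in> cells k c" "x \<in> A'" "y \<in> A'" "a = code x" "b = code y" by blast
    then have "mdist edge_space a b \<le> 3/2 * (1/2)^k" using cells_diameter by simp
    also have "\<dots> \<le> 12 * r" using k(1) by simp
    finally show "mdist edge_space a b \<le> 12 * r" .
  qed auto
  then show ?thesis by blast
qed

section \<open>Lipschitz dimension is not a snowflake invariant\<close>

theorem corollary8p4:
  shows "\<exists>(X :: (nat \<Rightarrow> real) metric) (Y :: (nat \<Rightarrow> real) metric) f.
           snowflake_map X Y f \<and>
           f ` mspace X = mspace Y \<and>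
           quasisymmetric_map X Y f \<and>
           homeomorphic_map (mtopology_of X) (mtopology_of Y) f \<and>
           Lipschitz_dim X \<noteq> Lipschitz_dim Y"
proof (intro exI conjI)
  show "snowflake_map edge_space (sqrt_metric edge_space) id"
    by (rule snowflake_map_id_sqrt_metric)
  show "id ` mspace edge_space = mspace (sqrt_metric edge_space)" by simp
  show "quasisymmetric_map edge_space (sqrt_metric edge_space) id"
    by (rule quasisymmetric_map_id_sqrt_metric)
  show "homeomorphic_map (mtopology_of edge_space) (mtopology_of (sqrt_metric edge_space)) id"
    by (rule homeomorphic_map_id_sqrt_metric)
  have "Lipschitz_dim edge_space = \<infinity>"
    using no_Lipschitz_light_edge_space by (simp add: Lipschitz_dim_def top_enat_def)
  moreover have "Lipschitz_dim (sqrt_metric edge_space) \<le> enat 5"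
    by (rule Lipschitz_dim_sqrt_metric_le[where R = 2 and D = 12])
       (use edge_space_separated_cover vdist_le_2 in auto)
  ultimately show "Lipschitz_dim edge_space \<noteq> Lipschitz_dim (sqrt_metric edge_space)" by auto
qed

end
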